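(* There exist absolute constants $c>0$ and $C>1$ such that the following holds. Let $0<\lambda<1$, let $n$ be a positive integer with $n> c/(1-\lambda)^2$, and let $p\in(0,1]$. For every $p$-convex body $K$ in $\mathbb{R}^n$ there exists an orthogonal projection $P$ of rank $[\lambda n]$ such that $$ PD \subset \frac{A_p\, M_K}{(1-\lambda)^{1+1/p}}\; PK, \qquad\text{where } A_p = C^{\frac{\ln(2/p)}{p}} .$$
   Context: $|\cdot|$ is a Euclidean norm on $\mathbb{R}^n$, $D$ is its closed unit ball, and $S^{n-1}$ its unit sphere with normalized rotation invariant measure $\sigma$; orthogonality is with respect to this Euclidean structure. $[x]$ denotes the integer part of $x$. A body $K\subset\mathbb{R}^n$ is a centrally symmetric compact star-body, i.e. a compact set with $tK\subset K$ for all $t\in[-1,1]$, with $0$ in its interior (so that its gauge is finite). For $p\in(0,1]$, $K$ is $p$-convex if for all $\alpha,\beta>0$ with $\alpha^p+\beta^p=1$ and all $x,y\in K$ one has $\alpha x+\beta y\in K$. The gauge of $K$ is $\|x\|_K=\inf\{s>0 : x\in sK\}$, and $M_K=\int_{S^{n-1}}\|x\|_K\,d\sigma(x)$. *)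

theory Defs
  imports "HOL-Analysis.Analysis" "HOL-Analysis.Finite_Function_Topology"
begin

text \<open>
  The dimension is quantified below the absolute constants of the theorem, so it cannot be a type;
  \<open>\<real>\<^sup>n\<close> is the subspace of finitely supported sequences living on the first \<open>n\<close> coordinates.
  The type \<open>nat \<Rightarrow>\<^sub>0 real\<close> carries the \<open>\<ell>\<^sub>1\<close> norm, whose topology on \<open>Rn n\<close> is the usual one; that
  norm is used for topology only. The Euclidean structure is a separate parameter \<open>ip\<close>, an arbitrary
  inner product on \<open>Rn n\<close>, whose values elsewhere are irrelevant.
\<close>

definition Rn :: "nat \<Rightarrow> (nat \<Rightarrow>\<^sub>0 real) set" where
  "Rn n = {x. Poly_Mapping.keys x \<subseteq> {..<n}}"

definition inner_product_on :: "nat \<Rightarrow> ((nat \<Rightarrow>\<^sub>0 real) \<Rightarrow> (nat \<Rightarrow>\<^sub>0 real) \<Rightarrow> real) \<Rightarrow> bool" where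
  "inner_product_on n ip \<longleftrightarrow>
     (\<forall>x\<in>Rn n. \<forall>y\<in>Rn n. ip x y = ip y x) \<and>
     (\<forall>x\<in>Rn n. \<forall>y\<in>Rn n. \<forall>z\<in>Rn n. ip (x + y) z = ip x z + ip y z) \<and>
     (\<forall>a. \<forall>x\<in>Rn n. \<forall>y\<in>Rn n. ip (a *\<^sub>R x) y = a * ip x y) \<and>
     (\<forall>x\<in>Rn n. x \<noteq> 0 \<longrightarrow> 0 < ip x x)"

definition enorm :: "((nat \<Rightarrow>\<^sub>0 real) \<Rightarrow> (nat \<Rightarrow>\<^sub>0 real) \<Rightarrow> real) \<Rightarrow> (nat \<Rightarrow>\<^sub>0 real) \<Rightarrow> real" where
  "enorm ip x = sqrt (ip x x)"

definition unit_ball :: "nat \<Rightarrow> ((nat \<Rightarrow>\<^sub>0 real) \<Rightarrow> (nat \<Rightarrow>\<^sub>0 real) \<Rightarrow> real) \<Rightarrow> (nat \<Rightarrow>\<^sub>0 real) set" where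
  "unit_ball n ip = {x \<in> Rn n. enorm ip x \<le> 1}"

definition unit_sphere :: "nat \<Rightarrow> ((nat \<Rightarrow>\<^sub>0 real) \<Rightarrow> (nat \<Rightarrow>\<^sub>0 real) \<Rightarrow> real) \<Rightarrow> (nat \<Rightarrow>\<^sub>0 real) set" where
  "unit_sphere n ip = {x \<in> Rn n. enorm ip x = 1}"

definition lebesgue_Rn :: "nat \<Rightarrow> (nat \<Rightarrow>\<^sub>0 real) measure" where
  "lebesgue_Rn n = distr (\<Pi>\<^sub>M i\<in>{..<n}. lborel) (restrict_space borel (Rn n))
                     (\<lambda>f. \<Sum>i<n. Poly_Mapping.single i (f i))"

text \<open>
  The measure on the sphere is the normalized cone measure, the image under radial projection of the
  uniform distribution on the ball (the origin is a null set). Lebesgue measure depends on the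
  coordinates and not on \<open>ip\<close>, but this only contributes a factor which the normalization cancels.
  \<open>space_sphere_measure\<close>, \<open>sphere_measure_normalized\<close> and \<open>sphere_measure_rotation_invariant\<close>
  below show that it is a Borel probability measure on the sphere that is invariant under all
  rotations with respect to \<open>ip\<close>.
\<close>

definition sphere_measure :: "nat \<Rightarrow> ((nat \<Rightarrow>\<^sub>0 real) \<Rightarrow> (nat \<Rightarrow>\<^sub>0 real) \<Rightarrow> real) \<Rightarrow> (nat \<Rightarrow>\<^sub>0 real) measure" where
  "sphere_measure n ip =
     restrict_space
       (distr (uniform_measure (lebesgue_Rn n) (unit_ball n ip)) (restrict_space borel (Rn n))
          (\<lambda>x. x /\<^sub>R enorm ip x))
       (unit_sphere n ip)"

text \<open>A nonempty open subset of \<^term>\<open>Rn n\<close> is not open in the ambient space, so the interior is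
  taken relative to \<^term>\<open>Rn n\<close>.\<close>

definition body :: "nat \<Rightarrow> (nat \<Rightarrow>\<^sub>0 real) set \<Rightarrow> bool" where
  "body n K \<longleftrightarrow>
     K \<subseteq> Rn n \<and> compact K \<and> (\<forall>t\<in>{-1..1}. (*\<^sub>R) t ` K \<subseteq> K) \<and>
     0 \<in> top_of_set (Rn n) interior_of K"

definition p_convex :: "real \<Rightarrow> 'a::real_vector set \<Rightarrow> bool" where
  "p_convex p K \<longleftrightarrow>
     (\<forall>\<alpha> \<beta>. 0 < \<alpha> \<and> 0 < \<beta> \<and> \<alpha> powr p + \<beta> powr p = 1 \<longrightarrow>
        (\<forall>x\<in>K. \<forall>y\<in>K. \<alpha> *\<^sub>R x + \<beta> *\<^sub>R y \<in> K))"

definition gauge_of :: "'a::real_vector set \<Rightarrow> 'a \<Rightarrow> real" where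
  "gauge_of K x = Inf {s. 0 < s \<and> x \<in> (*\<^sub>R) s ` K}"

definition mean_gauge :: "nat \<Rightarrow> ((nat \<Rightarrow>\<^sub>0 real) \<Rightarrow> (nat \<Rightarrow>\<^sub>0 real) \<Rightarrow> real) \<Rightarrow> (nat \<Rightarrow>\<^sub>0 real) set \<Rightarrow> real" where
  "mean_gauge n ip K = (LINT x|sphere_measure n ip. gauge_of K x)"

text \<open>The values of \<open>P\<close> outside \<^term>\<open>Rn n\<close> are irrelevant: every linear map on \<^term>\<open>Rn n\<close>
  extends to the whole type.\<close>

definition orthogonal_projection ::
  "nat \<Rightarrow> ((nat \<Rightarrow>\<^sub>0 real) \<Rightarrow> (nat \<Rightarrow>\<^sub>0 real) \<Rightarrow> real) \<Rightarrow> ((nat \<Rightarrow>\<^sub>0 real) \<Rightarrow> (nat \<Rightarrow>\<^sub>0 real)) \<Rightarrow> bool" where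
  "orthogonal_projection n ip P \<longleftrightarrow>
     linear P \<and> P ` Rn n \<subseteq> Rn n \<and> (\<forall>x\<in>Rn n. P (P x) = P x) \<and>
     (\<forall>x\<in>Rn n. \<forall>y\<in>Rn n. ip (P x) y = ip x (P y))"


lemma lookup_scaleR: "Poly_Mapping.lookup (a *\<^sub>R x) i = a *\<^sub>R Poly_Mapping.lookup x i"
proof -
  have "finite {i. a *\<^sub>R Poly_Mapping.lookup x i \<noteq> 0}"
    by (rule finite_subset[OF _ finite_keys[of x]]) (auto simp: in_keys_iff)
  then show ?thesis
    by (simp add: scaleR_poly_mapping_def)
qed

lemma lookup_sum: "Poly_Mapping.lookup (sum f A) i = (\<Sum>a\<in>A. Poly_Mapping.lookup (f a) i)"
  by (induction A rule: infinite_finite_induct) (auto simp: lookup_add)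

lemma mem_Rn: "x \<in> Rn n \<longleftrightarrow> (\<forall>i\<ge>n. Poly_Mapping.lookup x i = 0)"
  by (auto simp: Rn_def in_keys_iff subset_iff not_less[symmetric])

lemma subspace_Rn: "subspace (Rn n)"
  by (auto simp: subspace_def mem_Rn lookup_add lookup_scaleR)

lemma lookup_emb:
  fixes f :: "nat \<Rightarrow> real"
  shows "Poly_Mapping.lookup (\<Sum>i<n. Poly_Mapping.single i (f i)) j = (if j < n then f j else 0)"
  by (auto simp: lookup_sum lookup_single when_def sum.delta)

lemma emb_mem_Rn: "(\<Sum>i<n. Poly_Mapping.single i (f i)) \<in> Rn n"
  by (simp add: mem_Rn lookup_emb)

lemma Rn_expand:
  assumes "x \<in> Rn n"
  shows "x = (\<Sum>i<n. Poly_Mapping.lookup x i *\<^sub>R Poly_Mapping.single i 1)"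
  using assms by (intro poly_mapping_eqI) (auto simp: mem_Rn lookup_sum lookup_scaleR lookup_single when_def if_distrib[of "(*) _"] sum.delta cong: if_cong)

lemma single_eq_scaleR: "Poly_Mapping.single i a = a *\<^sub>R Poly_Mapping.single i (1::real)"
  by (intro poly_mapping_eqI) (auto simp: lookup_scaleR lookup_single when_def)

lemma abs_lookup_le_norm: "\<bar>Poly_Mapping.lookup (x::nat \<Rightarrow>\<^sub>0 real) i\<bar> \<le> norm x"
proof (cases "i \<in> Poly_Mapping.keys x")
  case True
  then show ?thesis
    by (auto simp: norm_poly_mapping_def dist_poly_mapping_def intro!: member_le_sum)
qed (simp add: in_keys_iff)

lemma bounded_linear_lookup: "bounded_linear (\<lambda>x::nat \<Rightarrow>\<^sub>0 real. Poly_Mapping.lookup x i)"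
  by (rule bounded_linear_intro[where K=1]) (auto simp: lookup_add lookup_scaleR abs_lookup_le_norm)

lemma closed_Rn: "closed (Rn n)"
proof -
  have "Rn n = (\<Inter>i\<in>{n..}. {x. Poly_Mapping.lookup x i = 0})"
    by (auto simp: mem_Rn)
  moreover have "closed {x::nat \<Rightarrow>\<^sub>0 real. Poly_Mapping.lookup x i = 0}" for i
    by (intro closed_Collect_eq continuous_intros
          linear_continuous_on bounded_linear_lookup)
  ultimately show ?thesis
    by auto
qed

abbreviation borel_Rn :: "nat \<Rightarrow> (nat \<Rightarrow>\<^sub>0 real) measure" where
  "borel_Rn n \<equiv> restrict_space borel (Rn n)"

lemma measurable_emb: "(\<lambda>f. \<Sum>i<n. Poly_Mapping.single i (f i)) \<in> (\<Pi>\<^sub>M i\<in>{..<n}. lborel) \<rightarrow>\<^sub>M borel_Rn n"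
proof (rule measurable_restrict_space2)
  let ?ext = "\<lambda>f i. if i < n then f i else (0::real)"
  have "continuous_on UNIV (\<lambda>f::nat \<Rightarrow> real. \<Sum>i<n. f i *\<^sub>R Poly_Mapping.single i (1::real))"
    by (intro continuous_intros) auto
  then have 1: "(\<lambda>f::nat \<Rightarrow> real. \<Sum>i<n. f i *\<^sub>R Poly_Mapping.single i (1::real)) \<in> borel_measurable borel"
    by (rule borel_measurable_continuous_onI)
  have 2: "?ext \<in> (\<Pi>\<^sub>M i\<in>{..<n}. lborel) \<rightarrow>\<^sub>M borel"
  proof (rule measurable_coordinatewise_then_product)
    fix i :: nat
    show "(\<lambda>f. ?ext f i) \<in> borel_measurable (\<Pi>\<^sub>M i\<in>{..<n}. lborel)"
    proof (cases "i < n")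
      case True
      then have "(\<lambda>f. f i) \<in> (\<Pi>\<^sub>M i\<in>{..<n}. lborel) \<rightarrow>\<^sub>M (lborel :: real measure)"
        by (intro measurable_component_singleton) auto
      then show ?thesis
        using True by simp
    qed simp
  qed
  have "(\<lambda>f. \<Sum>i<n. ?ext f i *\<^sub>R Poly_Mapping.single i (1::real)) \<in> borel_measurable (\<Pi>\<^sub>M i\<in>{..<n}. lborel)"
    by (rule measurable_compose[OF 2 1])
  also have "(\<lambda>f. \<Sum>i<n. ?ext f i *\<^sub>R Poly_Mapping.single i (1::real)) = (\<lambda>f. \<Sum>i<n. Poly_Mapping.single i (f i))"
    by (intro ext sum.cong) (auto simp: single_eq_scaleR[symmetric])
  finally show "(\<lambda>f. \<Sum>i<n. Poly_Mapping.single i (f i :: real)) \<in> borel_measurable (\<Pi>\<^sub>M i\<in>{..<n}. lborel)" .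
qed (auto simp: emb_mem_Rn)

lemma measurable_lookup: "(\<lambda>x. Poly_Mapping.lookup x i) \<in> borel_measurable (borel_Rn n)"
  by (intro measurable_restrict_space1 borel_measurable_continuous_onI
        linear_continuous_on bounded_linear_lookup)

lemma measurable_coords:
  "(\<lambda>x. \<lambda>i\<in>{..<n}. Poly_Mapping.lookup x i) \<in> borel_Rn n \<rightarrow>\<^sub>M (\<Pi>\<^sub>M i\<in>{..<n}. lborel)"
  using measurable_lookup by (intro measurable_restrict) auto

lemma emb_coords:
  assumes "x \<in> Rn n"
  shows "(\<Sum>i<n. Poly_Mapping.single i ((\<lambda>i\<in>{..<n}. Poly_Mapping.lookup x i) i)) = x"
  using assms by (intro poly_mapping_eqI) (auto simp: lookup_emb mem_Rn)

text \<open>A map into \<^term>\<open>Rn n\<close> is measurable as soon as its coordinates are.\<close>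

lemma measurable_into_Rn:
  assumes "\<And>i. i < n \<Longrightarrow> (\<lambda>x. Poly_Mapping.lookup (f x) i) \<in> borel_measurable M"
    and "\<And>x. x \<in> space M \<Longrightarrow> f x \<in> Rn n"
  shows "f \<in> M \<rightarrow>\<^sub>M borel_Rn n"
proof -
  have "(\<lambda>x. \<lambda>i\<in>{..<n}. Poly_Mapping.lookup (f x) i) \<in> M \<rightarrow>\<^sub>M (\<Pi>\<^sub>M i\<in>{..<n}. lborel)"
    using assms(1) by (intro measurable_restrict) auto
  from measurable_compose[OF this measurable_emb]
  have "(\<lambda>x. \<Sum>i<n. Poly_Mapping.single i ((\<lambda>i\<in>{..<n}. Poly_Mapping.lookup (f x) i) i)) \<in> M \<rightarrow>\<^sub>M borel_Rn n" .
  then show ?thesis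
    by (rule measurable_cong[THEN iffD1, rotated]) (intro emb_coords assms(2))
qed

lemma sets_lebesgue_Rn [measurable_cong]: "sets (lebesgue_Rn n) = sets (borel_Rn n)"
  by (simp add: lebesgue_Rn_def)

lemma space_borel_Rn [simp]: "space (borel_Rn n) = Rn n"
  by (simp add: space_restrict_space)

lemma space_lebesgue_Rn [simp]: "space (lebesgue_Rn n) = Rn n"
  by (simp add: lebesgue_Rn_def space_restrict_space)

lemma distr_coords:
  "distr (lebesgue_Rn n) (\<Pi>\<^sub>M i\<in>{..<n}. lborel) (\<lambda>x. \<lambda>i\<in>{..<n}. Poly_Mapping.lookup x i) =
     (\<Pi>\<^sub>M i\<in>{..<n}. lborel)"
proof -
  have "distr (lebesgue_Rn n) (\<Pi>\<^sub>M i\<in>{..<n}. lborel) (\<lambda>x. \<lambda>i\<in>{..<n}. Poly_Mapping.lookup x i) =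
      distr (\<Pi>\<^sub>M i\<in>{..<n}. lborel) (\<Pi>\<^sub>M i\<in>{..<n}. lborel) (\<lambda>x. x)"
    unfolding lebesgue_Rn_def
    by (subst distr_distr[OF measurable_coords measurable_emb], intro distr_cong refl)
       (auto simp: lookup_emb space_PiM PiE_def extensional_def fun_eq_iff restrict_def)
  then show ?thesis
    by simp
qed

interpretation lborel_product: product_sigma_finite "\<lambda>_::nat. lborel :: real measure"
  by standard

lemma sigma_finite_lebesgue_Rn: "sigma_finite_measure (lebesgue_Rn n)"
proof (rule sigma_finite_measure_distr)
  show "(\<lambda>x. \<lambda>i\<in>{..<n}. Poly_Mapping.lookup x i) \<in> lebesgue_Rn n \<rightarrow>\<^sub>M (\<Pi>\<^sub>M i\<in>{..<n}. lborel)"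
    using measurable_coords by (simp cong: measurable_cong_sets add: sets_lebesgue_Rn)
  show "sigma_finite_measure (distr (lebesgue_Rn n) (\<Pi>\<^sub>M i\<in>{..<n}. lborel)
          (\<lambda>x. \<lambda>i\<in>{..<n}. Poly_Mapping.lookup x i))"
    by (simp add: distr_coords lborel_product.sigma_finite)
qed

lemma emeasure_lebesgue_Rn_box:
  assumes "\<And>i. i < n \<Longrightarrow> B i \<in> sets borel"
  shows "{x \<in> Rn n. \<forall>i<n. Poly_Mapping.lookup x i \<in> B i} \<in> sets (borel_Rn n)"
    and "emeasure (lebesgue_Rn n) {x \<in> Rn n. \<forall>i<n. Poly_Mapping.lookup x i \<in> B i} =
           (\<Prod>i<n. emeasure lborel (B i))"
proof -
  let ?X = "{x \<in> Rn n. \<forall>i<n. Poly_Mapping.lookup x i \<in> B i}"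
  have "restrict f {..<n} \<in> (\<Pi>\<^sub>E i\<in>{..<n}. B i) \<longleftrightarrow> (\<forall>i<n. f i \<in> B i)" for f
    unfolding PiE_iff by auto
  then have X: "?X = (\<lambda>x. \<lambda>i\<in>{..<n}. Poly_Mapping.lookup x i) -` (\<Pi>\<^sub>E i\<in>{..<n}. B i) \<inter> Rn n"
    by (simp only: vimage_def) blast
  have P: "(\<Pi>\<^sub>E i\<in>{..<n}. B i) \<in> sets (\<Pi>\<^sub>M i\<in>{..<n}. lborel)"
    using assms by (intro sets_PiM_I_finite) auto
  show "?X \<in> sets (borel_Rn n)"
    using measurable_sets[OF measurable_coords P] by (simp add: X)
  have meas: "(\<lambda>x. \<lambda>i\<in>{..<n}. Poly_Mapping.lookup x i) \<in> lebesgue_Rn n \<rightarrow>\<^sub>M (\<Pi>\<^sub>M i\<in>{..<n}. lborel)"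
    using measurable_coords by (simp cong: measurable_cong_sets add: sets_lebesgue_Rn)
  have "emeasure (lebesgue_Rn n) ?X =
      emeasure (distr (lebesgue_Rn n) (\<Pi>\<^sub>M i\<in>{..<n}. lborel) (\<lambda>x. \<lambda>i\<in>{..<n}. Poly_Mapping.lookup x i))
        (\<Pi>\<^sub>E i\<in>{..<n}. B i)"
    using emeasure_distr[OF meas P] by (simp add: X)
  also have "\<dots> = (\<Prod>i<n. emeasure lborel (B i))"
    unfolding distr_coords using assms by (intro lborel_product.emeasure_PiM) auto
  finally show "emeasure (lebesgue_Rn n) ?X = (\<Prod>i<n. emeasure lborel (B i))" .
qed

text \<open>A coordinatewise Lebesgue-preserving map preserves \<^term>\<open>lebesgue_Rn n\<close>;
  this covers translations and the reflection at the origin.\<close>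

lemma distr_lebesgue_Rn_coordwise:
  assumes g: "\<And>i. i < n \<Longrightarrow> g i \<in> borel_measurable borel"
    and gd: "\<And>i. i < n \<Longrightarrow> distr lborel borel (g i) = (lborel :: real measure)"
    and f: "\<And>x. x \<in> Rn n \<Longrightarrow> f x \<in> Rn n"
    and fg: "\<And>x i. x \<in> Rn n \<Longrightarrow> i < n \<Longrightarrow> Poly_Mapping.lookup (f x) i = g i (Poly_Mapping.lookup x i)"
  shows "f \<in> borel_Rn n \<rightarrow>\<^sub>M borel_Rn n" "distr (lebesgue_Rn n) (borel_Rn n) f = lebesgue_Rn n"
proof -
  let ?c = "\<lambda>x. \<lambda>i\<in>{..<n}. Poly_Mapping.lookup x i"
  let ?P = "(\<Pi>\<^sub>M i\<in>{..<n}. lborel) :: (nat \<Rightarrow> real) measure"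
  show f_meas: "f \<in> borel_Rn n \<rightarrow>\<^sub>M borel_Rn n"
  proof (rule measurable_into_Rn)
    fix i assume i: "i < n"
    have "(\<lambda>x. g i (Poly_Mapping.lookup x i)) \<in> borel_measurable (borel_Rn n)"
      by (rule measurable_compose[OF measurable_lookup g[OF i]])
    then show "(\<lambda>x. Poly_Mapping.lookup (f x) i) \<in> borel_measurable (borel_Rn n)"
      by (rule measurable_cong[THEN iffD1, rotated]) (simp add: fg i)
  qed (simp add: f)
  have f_meas': "f \<in> lebesgue_Rn n \<rightarrow>\<^sub>M borel_Rn n"
    using f_meas by (simp cong: measurable_cong_sets add: sets_lebesgue_Rn)
  have c_meas: "?c \<in> distr (lebesgue_Rn n) (borel_Rn n) f \<rightarrow>\<^sub>M ?P"
    using measurable_coords by (simp cong: measurable_cong_sets)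
  have eq: "distr (distr (lebesgue_Rn n) (borel_Rn n) f) ?P ?c = ?P"
  proof (rule lborel_product.PiM_eqI)
    fix A :: "nat \<Rightarrow> real set"
    assume "\<And>i. i \<in> {..<n} \<Longrightarrow> A i \<in> sets lborel"
    then have A: "\<And>i. i < n \<Longrightarrow> A i \<in> sets borel"
      by simp
    have PA: "Pi\<^sub>E {..<n} A \<in> sets ?P"
      using A by (intro sets_PiM_I_finite) auto
    have "emeasure (distr (distr (lebesgue_Rn n) (borel_Rn n) f) ?P ?c) (Pi\<^sub>E {..<n} A)
        = emeasure (distr (lebesgue_Rn n) (borel_Rn n) f) (?c -` Pi\<^sub>E {..<n} A \<inter> Rn n)"
      using emeasure_distr[OF c_meas PA] by simp
    also have "\<dots> = emeasure (lebesgue_Rn n) (f -` (?c -` Pi\<^sub>E {..<n} A \<inter> Rn n) \<inter> Rn n)"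
      using measurable_sets[OF measurable_coords PA] f_meas' by (subst emeasure_distr) auto
    also have "f -` (?c -` Pi\<^sub>E {..<n} A \<inter> Rn n) \<inter> Rn n =
        {x \<in> Rn n. \<forall>i<n. Poly_Mapping.lookup x i \<in> g i -` A i}"
      using f fg by (auto simp: PiE_iff)
    also have "emeasure (lebesgue_Rn n) \<dots> = (\<Prod>i<n. emeasure lborel (g i -` A i))"
    proof (rule emeasure_lebesgue_Rn_box)
      show "g i -` A i \<in> sets borel" if "i < n" for i
        using measurable_sets[OF g[OF that] A[OF that]] by simp
    qed
    also have "\<dots> = (\<Prod>i<n. emeasure lborel (A i))"
    proof (rule prod.cong[OF refl])
      fix i assume "i \<in> {..<n}"
      then have i: "i < n" by simp
      have "emeasure lborel (A i) = emeasure (distr lborel borel (g i)) (A i)"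
        by (simp add: gd i)
      also have "\<dots> = emeasure lborel (g i -` A i)"
        using g[OF i] A[OF i] by (subst emeasure_distr) auto
      finally show "emeasure lborel (g i -` A i) = emeasure lborel (A i)" ..
    qed
    finally show "emeasure (distr (distr (lebesgue_Rn n) (borel_Rn n) f) ?P ?c) (Pi\<^sub>E {..<n} A) =
        (\<Prod>i\<in>{..<n}. emeasure lborel (A i))" .
  qed auto
  have "distr (distr (lebesgue_Rn n) (borel_Rn n) f) (borel_Rn n) (\<lambda>x. x) =
      distr (distr (distr (lebesgue_Rn n) (borel_Rn n) f) ?P ?c) (borel_Rn n)
        (\<lambda>h. \<Sum>i<n. Poly_Mapping.single i (h i))"
    by (subst distr_distr[OF measurable_emb c_meas], intro distr_cong refl)
       (simp del: restrict_apply add: emb_coords)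
  also have "\<dots> = lebesgue_Rn n"
    by (simp only: eq lebesgue_Rn_def[symmetric])
  also have "distr (distr (lebesgue_Rn n) (borel_Rn n) f) (borel_Rn n) (\<lambda>x. x) = distr (lebesgue_Rn n) (borel_Rn n) f"
    by (rule distr_id2) simp
  finally show "distr (lebesgue_Rn n) (borel_Rn n) f = lebesgue_Rn n" .
qed


lemma translation_lebesgue_Rn:
  assumes "a \<in> Rn n"
  shows "distr (lebesgue_Rn n) (borel_Rn n) (\<lambda>x. x + a) = lebesgue_Rn n"
proof (rule distr_lebesgue_Rn_coordwise(2)[where g = "\<lambda>i t. Poly_Mapping.lookup a i + t"])
  show "distr lborel borel ((+) (Poly_Mapping.lookup a i)) = (lborel :: real measure)" for i
    by (rule lborel_distr_plus)
qed (use assms in \<open>auto simp: lookup_add subspace_add[OF subspace_Rn]\<close>)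

lemma reflection_lebesgue_Rn:
  assumes "a \<in> Rn n"
  shows "distr (lebesgue_Rn n) (borel_Rn n) (\<lambda>x. a - x) = lebesgue_Rn n"
proof (rule distr_lebesgue_Rn_coordwise(2)[where g = "\<lambda>i t. Poly_Mapping.lookup a i - t"])
  fix i
  have "distr lborel borel ((\<lambda>t. Poly_Mapping.lookup a i - t)) =
      distr (distr lborel borel uminus) borel ((+) (Poly_Mapping.lookup a i))"
    by (subst distr_distr) (auto simp: o_def)
  also have "\<dots> = (lborel :: real measure)"
    unfolding lborel_distr_uminus by (rule lborel_distr_plus)
  finally show "distr lborel borel (\<lambda>t. Poly_Mapping.lookup a i - t) = (lborel :: real measure)" .
qed (use assms in \<open>auto simp: lookup_minus subspace_diff[OF subspace_Rn]\<close>)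

lemma measurable_Rn_add:
  assumes "f \<in> M \<rightarrow>\<^sub>M borel_Rn n" "g \<in> M \<rightarrow>\<^sub>M borel_Rn n"
  shows "(\<lambda>x. f x + g x) \<in> M \<rightarrow>\<^sub>M borel_Rn n" "(\<lambda>x. f x - g x) \<in> M \<rightarrow>\<^sub>M borel_Rn n"
proof -
  have l: "(\<lambda>x. Poly_Mapping.lookup (f x) i) \<in> borel_measurable M"
    "(\<lambda>x. Poly_Mapping.lookup (g x) i) \<in> borel_measurable M" for i
    using assms by (auto intro: measurable_compose[OF _ measurable_lookup])
  have s: "f x \<in> Rn n" "g x \<in> Rn n" if "x \<in> space M" for x
    using assms[THEN measurable_space, OF that] by auto
  show "(\<lambda>x. f x + g x) \<in> M \<rightarrow>\<^sub>M borel_Rn n"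
    by (rule measurable_into_Rn) (auto simp: lookup_add s subspace_add[OF subspace_Rn] intro!: borel_measurable_add l)
  show "(\<lambda>x. f x - g x) \<in> M \<rightarrow>\<^sub>M borel_Rn n"
    by (rule measurable_into_Rn) (auto simp: lookup_minus s subspace_diff[OF subspace_Rn] intro!: borel_measurable_diff l)
qed

lemma translation_invariant_proportional:
  assumes sets_nu: "sets \<nu> = sets (borel_Rn n)" and sf: "sigma_finite_measure \<nu>"
    and inv: "\<And>a. a \<in> Rn n \<Longrightarrow> distr \<nu> (borel_Rn n) (\<lambda>x. x + a) = \<nu>"
    and A: "A \<in> sets (borel_Rn n)" and B: "B \<in> sets (borel_Rn n)"
  shows "emeasure \<nu> A * emeasure (lebesgue_Rn n) B = emeasure \<nu> B * emeasure (lebesgue_Rn n) A"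
proof -
  let ?L = "lebesgue_Rn n" and ?M = "borel_Rn n"
  note [measurable_cong] = sets_nu
  note [measurable] = A B
  interpret L: sigma_finite_measure ?L by (rule sigma_finite_lebesgue_Rn)
  interpret N: sigma_finite_measure \<nu> by (rule sf)
  interpret P: pair_sigma_finite \<nu> ?L ..
  have space_nu [simp]: "space \<nu> = Rn n"
    using sets_eq_imp_space_eq[OF sets_nu] by simp
  have AL: "A \<in> sets ?L" "B \<in> sets ?L" "A \<in> sets \<nu>" "B \<in> sets \<nu>"
    using A B by (auto simp: sets_nu sets_lebesgue_Rn)
  have [measurable]: "(\<lambda>x. x + a) \<in> ?M \<rightarrow>\<^sub>M ?M" "(\<lambda>x. a - x) \<in> ?M \<rightarrow>\<^sub>M ?M" if "a \<in> Rn n" for a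
    using that by (auto intro!: measurable_Rn_add)
  have [measurable]: "(\<lambda>z. snd z + fst z) \<in> ?M \<Otimes>\<^sub>M ?M \<rightarrow>\<^sub>M ?M" "(\<lambda>z. fst z - snd z) \<in> ?M \<Otimes>\<^sub>M ?M \<rightarrow>\<^sub>M ?M"
    by (auto intro!: measurable_Rn_add)
  have [measurable]: "(indicator A :: _ \<Rightarrow> ennreal) \<in> borel_measurable ?M" "(indicator B :: _ \<Rightarrow> ennreal) \<in> borel_measurable ?M"
    by auto
  have shiftB: "(\<integral>\<^sup>+y. indicator B (y + x) \<partial>?L) = emeasure ?L B" if "x \<in> Rn n" for x
  proof -
    have "(\<integral>\<^sup>+y. indicator B (y + x) \<partial>?L) = (\<integral>\<^sup>+y. indicator B y \<partial>distr ?L ?M (\<lambda>y. y + x))"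
      using that by (subst nn_integral_distr) auto
    then show ?thesis
      using AL by (simp add: translation_lebesgue_Rn[OF that])
  qed
  have reflA: "(\<integral>\<^sup>+y. indicator A (x - y) \<partial>?L) = emeasure ?L A" if "x \<in> Rn n" for x
  proof -
    have "(\<integral>\<^sup>+y. indicator A (x - y) \<partial>?L) = (\<integral>\<^sup>+y. indicator A y \<partial>distr ?L ?M (\<lambda>y. x - y))"
      using that by (subst nn_integral_distr) auto
    then show ?thesis
      using AL by (simp add: reflection_lebesgue_Rn[OF that])
  qed
  have shift: "(\<integral>\<^sup>+x. indicator A x * indicator B (y + x) \<partial>\<nu>) =
      (\<integral>\<^sup>+x. indicator A (x - y) * indicator B x \<partial>\<nu>)" if y: "y \<in> Rn n" for y
  proof -
    have "(\<lambda>x. x - y) \<in> ?M \<rightarrow>\<^sub>M ?M"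
      using y by (auto intro!: measurable_Rn_add)
    then have m: "(\<lambda>x. indicator A (x - y) * indicator B x :: ennreal) \<in> borel_measurable ?M"
      by measurable
    have "(\<integral>\<^sup>+x. indicator A (x - y) * indicator B x \<partial>\<nu>) =
        (\<integral>\<^sup>+x. indicator A (x - y) * indicator B x \<partial>distr \<nu> ?M (\<lambda>x. x + y))"
      by (simp add: inv y)
    also have "\<dots> = (\<integral>\<^sup>+x. indicator A x * indicator B (y + x) \<partial>\<nu>)"
      using y m by (subst nn_integral_distr) (auto simp: add.commute)
    finally show ?thesis ..
  qed
  have "emeasure \<nu> A * emeasure ?L B = (\<integral>\<^sup>+x. indicator A x * emeasure ?L B \<partial>\<nu>)"
    using AL by (simp add: nn_integral_multc)
  also have "\<dots> = (\<integral>\<^sup>+x. (\<integral>\<^sup>+y. indicator A x * indicator B (y + x) \<partial>?L) \<partial>\<nu>)"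
    by (intro nn_integral_cong) (subst nn_integral_cmult, auto simp: shiftB)
  also have "\<dots> = (\<integral>\<^sup>+y. (\<integral>\<^sup>+x. indicator A x * indicator B (y + x) \<partial>\<nu>) \<partial>?L)"
    by (rule P.Fubini'[symmetric]) (simp add: case_prod_beta)
  also have "\<dots> = (\<integral>\<^sup>+y. (\<integral>\<^sup>+x. indicator A (x - y) * indicator B x \<partial>\<nu>) \<partial>?L)"
    by (rule nn_integral_cong, rule shift) simp
  also have "\<dots> = (\<integral>\<^sup>+x. (\<integral>\<^sup>+y. indicator A (x - y) * indicator B x \<partial>?L) \<partial>\<nu>)"
    by (rule P.Fubini') (simp add: case_prod_beta)
  also have "\<dots> = (\<integral>\<^sup>+x. emeasure ?L A * indicator B x \<partial>\<nu>)"
    by (intro nn_integral_cong) (subst nn_integral_multc, auto simp: reflA)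
  also have "\<dots> = emeasure \<nu> B * emeasure ?L A"
    using AL by (subst nn_integral_cmult) (auto simp: mult.commute)
  finally show ?thesis .
qed

abbreviation std_vec :: "nat \<Rightarrow> (nat \<Rightarrow>\<^sub>0 real)" where
  "std_vec i \<equiv> Poly_Mapping.single i 1"

lemma std_vec_mem_Rn: "i < n \<Longrightarrow> std_vec i \<in> Rn n"
  by (auto simp: mem_Rn lookup_single when_def)

lemma inner_product_onD:
  assumes "inner_product_on n ip"
  shows "x \<in> Rn n \<Longrightarrow> y \<in> Rn n \<Longrightarrow> ip x y = ip y x"
    and "x \<in> Rn n \<Longrightarrow> y \<in> Rn n \<Longrightarrow> z \<in> Rn n \<Longrightarrow> ip (x + y) z = ip x z + ip y z"
    and "x \<in> Rn n \<Longrightarrow> y \<in> Rn n \<Longrightarrow> ip (a *\<^sub>R x) y = a * ip x y"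
    and "x \<in> Rn n \<Longrightarrow> x \<noteq> 0 \<Longrightarrow> 0 < ip x x"
  using assms unfolding inner_product_on_def by simp_all

lemma ip_sum_left:
  assumes ip: "inner_product_on n ip" and v: "\<And>i. i \<in> A \<Longrightarrow> v i \<in> Rn n" and y: "y \<in> Rn n"
    and fin: "finite A"
  shows "ip (\<Sum>i\<in>A. a i *\<^sub>R v i) y = (\<Sum>i\<in>A. a i * ip (v i) y)"
  using fin v
proof (induction A)
  case empty
  have "ip (0 *\<^sub>R 0) y = 0 * ip 0 y"
    by (rule inner_product_onD(3)[OF ip subspace_0[OF subspace_Rn] y])
  then show ?case by simp
next
  case (insert j A)
  have 1: "a j *\<^sub>R v j \<in> Rn n" "(\<Sum>i\<in>A. a i *\<^sub>R v i) \<in> Rn n"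
    using insert.prems by (auto intro!: subspace_scale[OF subspace_Rn] subspace_sum[OF subspace_Rn])
  have "ip (a j *\<^sub>R v j + (\<Sum>i\<in>A. a i *\<^sub>R v i)) y = ip (a j *\<^sub>R v j) y + ip (\<Sum>i\<in>A. a i *\<^sub>R v i) y"
    by (rule inner_product_onD(2)[OF ip 1 y])
  also have "ip (a j *\<^sub>R v j) y = a j * ip (v j) y"
    using y insert.prems by (intro inner_product_onD(3)[OF ip]) auto
  finally show ?case
    using insert by simp
qed

lemma ip_expand:
  assumes ip: "inner_product_on n ip" and x: "x \<in> Rn n" and y: "y \<in> Rn n"
  shows "ip x y = (\<Sum>i<n. \<Sum>j<n. Poly_Mapping.lookup x i * Poly_Mapping.lookup y j * ip (std_vec i) (std_vec j))"
proof -
  have sym: "ip u v = ip v u" if "u \<in> Rn n" "v \<in> Rn n" for u v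
    using that by (rule inner_product_onD(1)[OF ip])
  have 1: "ip (std_vec i) y = (\<Sum>j<n. Poly_Mapping.lookup y j * ip (std_vec i) (std_vec j))" if "i < n" for i
  proof -
    have "ip (std_vec i) y = ip (\<Sum>j<n. Poly_Mapping.lookup y j *\<^sub>R std_vec j) (std_vec i)"
      using sym[of "std_vec i" y] that y by (simp add: std_vec_mem_Rn Rn_expand[symmetric])
    also have "\<dots> = (\<Sum>j<n. Poly_Mapping.lookup y j * ip (std_vec j) (std_vec i))"
      using that by (intro ip_sum_left[OF ip]) (auto simp: std_vec_mem_Rn)
    also have "\<dots> = (\<Sum>j<n. Poly_Mapping.lookup y j * ip (std_vec i) (std_vec j))"
      using that by (intro sum.cong refl) (simp add: sym std_vec_mem_Rn)
    finally show ?thesis .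
  qed
  have "ip x y = ip (\<Sum>i<n. Poly_Mapping.lookup x i *\<^sub>R std_vec i) y"
    using x by (simp add: Rn_expand[symmetric])
  also have "\<dots> = (\<Sum>i<n. Poly_Mapping.lookup x i * ip (std_vec i) y)"
    using y by (intro ip_sum_left[OF ip]) (auto simp: std_vec_mem_Rn)
  also have "\<dots> = (\<Sum>i<n. \<Sum>j<n. Poly_Mapping.lookup x i * Poly_Mapping.lookup y j * ip (std_vec i) (std_vec j))"
    by (intro sum.cong refl) (simp add: 1 sum_distrib_left mult.assoc)
  finally show ?thesis .
qed

lemma measurable_enorm:
  assumes "inner_product_on n ip"
  shows "enorm ip \<in> borel_measurable (borel_Rn n)"
proof -
  have "(\<lambda>x. sqrt (\<Sum>i<n. \<Sum>j<n. Poly_Mapping.lookup x i * Poly_Mapping.lookup x j * ip (std_vec i) (std_vec j)))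
      \<in> borel_measurable (borel_Rn n)"
    using measurable_lookup by measurable
  then show ?thesis
    by (rule measurable_cong[THEN iffD1, rotated]) (simp add: enorm_def ip_expand[OF assms, symmetric])
qed

lemma sets_unit_ball:
  assumes "inner_product_on n ip"
  shows "unit_ball n ip \<in> sets (borel_Rn n)" "unit_sphere n ip \<in> sets (borel_Rn n)"
proof -
  note [measurable] = measurable_enorm[OF assms]
  have "{x \<in> space (borel_Rn n). enorm ip x \<le> 1} \<in> sets (borel_Rn n)"
    "{x \<in> space (borel_Rn n). enorm ip x = 1} \<in> sets (borel_Rn n)"
    by measurable
  then show "unit_ball n ip \<in> sets (borel_Rn n)" "unit_sphere n ip \<in> sets (borel_Rn n)"
    by (simp_all add: unit_ball_def unit_sphere_def)
qed

lemma emeasure_cube: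
  assumes "0 \<le> r"
  shows "{x \<in> Rn n. \<forall>i<n. \<bar>Poly_Mapping.lookup x i\<bar> \<le> r} \<in> sets (lebesgue_Rn n)"
    and "emeasure (lebesgue_Rn n) {x \<in> Rn n. \<forall>i<n. \<bar>Poly_Mapping.lookup x i\<bar> \<le> r} = ennreal (2 * r) ^ n"
proof -
  have *: "\<bar>t\<bar> \<le> r \<longleftrightarrow> t \<in> {-r..r}" for t :: real
    by auto
  show "{x \<in> Rn n. \<forall>i<n. \<bar>Poly_Mapping.lookup x i\<bar> \<le> r} \<in> sets (lebesgue_Rn n)"
    unfolding * sets_lebesgue_Rn by (rule emeasure_lebesgue_Rn_box(1)) simp
  show "emeasure (lebesgue_Rn n) {x \<in> Rn n. \<forall>i<n. \<bar>Poly_Mapping.lookup x i\<bar> \<le> r} = ennreal (2 * r) ^ n"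
    unfolding * using assms by (subst emeasure_lebesgue_Rn_box(2)) auto
qed

lemma cube_subset_unit_ball:
  assumes ip: "inner_product_on n ip"
  obtains r where "0 < r" "{x \<in> Rn n. \<forall>i<n. \<bar>Poly_Mapping.lookup x i\<bar> \<le> r} \<subseteq> unit_ball n ip"
proof -
  define G where "G = 1 + (\<Sum>i<n. \<Sum>j<n. \<bar>ip (std_vec i) (std_vec j)\<bar>)"
  have G: "1 \<le> G"
    unfolding G_def by (simp add: sum_nonneg)
  show ?thesis
  proof (rule that)
    show "0 < 1 / G"
      using G by simp
    show "{x \<in> Rn n. \<forall>i<n. \<bar>Poly_Mapping.lookup x i\<bar> \<le> 1 / G} \<subseteq> unit_ball n ip"
    proof safe
      fix x assume x: "x \<in> Rn n" and b: "\<forall>i<n. \<bar>Poly_Mapping.lookup x i\<bar> \<le> 1 / G"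
      have "ip x x \<le> (\<Sum>i<n. \<Sum>j<n. (1 / G) * (1 / G) * \<bar>ip (std_vec i) (std_vec j)\<bar>)"
        unfolding ip_expand[OF ip x x]
      proof (intro sum_mono)
        fix i j assume "i \<in> {..<n}" "j \<in> {..<n}"
        then have "\<bar>Poly_Mapping.lookup x i\<bar> * \<bar>Poly_Mapping.lookup x j\<bar> \<le> (1 / G) * (1 / G)"
          using b G by (intro mult_mono) auto
        then have "\<bar>Poly_Mapping.lookup x i\<bar> * \<bar>Poly_Mapping.lookup x j\<bar> * \<bar>ip (std_vec i) (std_vec j)\<bar>
            \<le> (1 / G) * (1 / G) * \<bar>ip (std_vec i) (std_vec j)\<bar>"
          by (rule mult_right_mono) simp
        then show "Poly_Mapping.lookup x i * Poly_Mapping.lookup x j * ip (std_vec i) (std_vec j)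
            \<le> (1 / G) * (1 / G) * \<bar>ip (std_vec i) (std_vec j)\<bar>"
          using abs_ge_self[of "Poly_Mapping.lookup x i * Poly_Mapping.lookup x j * ip (std_vec i) (std_vec j)"]
          by (simp add: abs_mult)
      qed
      also have "\<dots> = (1 / G) * (1 / G) * (G - 1)"
        by (simp add: G_def sum_distrib_left)
      also have "\<dots> \<le> (1 / G) * (1 / G) * G"
        using G by (intro mult_left_mono) auto
      also have "\<dots> \<le> 1"
        using G by (simp add: field_simps)
      finally show "x \<in> unit_ball n ip"
        using x by (simp add: unit_ball_def enorm_def)
    qed
  qed
qed

lemma unit_ball_subset_cube:
  assumes ip: "inner_product_on n ip" and n: "0 < n"
  obtains r where "0 \<le> r" "unit_ball n ip \<subseteq> {x \<in> Rn n. \<forall>i<n. \<bar>Poly_Mapping.lookup x i\<bar> \<le> r}"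
proof -
  define q :: "(nat \<Rightarrow> real) \<Rightarrow> real" where
    "q = (\<lambda>f. \<Sum>i<n. \<Sum>j<n. f i * f j * ip (std_vec i) (std_vec j))"
  define C where "C = {f::nat \<Rightarrow> real. (\<forall>i\<ge>n. f i = 0) \<and> (\<Sum>i<n. \<bar>f i\<bar>) = 1}"
  have "compactin (product_topology (\<lambda>_. euclidean) UNIV) (\<Pi>\<^sub>E i\<in>(UNIV::nat set). {-1..1::real})"
    by (subst compactin_PiE) auto
  then have cube: "compact (\<Pi>\<^sub>E i\<in>(UNIV::nat set). {-1..1::real})"
    by (simp add: euclidean_product_topology)
  have sub: "C \<subseteq> (\<Pi>\<^sub>E i\<in>(UNIV::nat set). {-1..1})"
  proof
    fix f assume f: "f \<in> C"
    have "\<bar>f i\<bar> \<le> 1" for i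
    proof (cases "i < n")
      case True
      then have "\<bar>f i\<bar> \<le> (\<Sum>i<n. \<bar>f i\<bar>)"
        by (intro member_le_sum) auto
      then show ?thesis
        using f by (simp add: C_def)
    qed (use f in \<open>auto simp: C_def\<close>)
    then show "f \<in> (\<Pi>\<^sub>E i\<in>(UNIV::nat set). {-1..1})"
      by (auto simp: abs_le_iff minus_le_iff)
  qed
  have C_eq: "C = (\<Inter>i\<in>{n..}. {f. f i = 0}) \<inter> {f. (\<Sum>i<n. \<bar>f i\<bar>) = 1}"
    by (auto simp: C_def)
  have "closed C"
    unfolding C_eq
    by (intro closed_Int closed_INT ballI closed_Collect_eq continuous_intros continuous_on_product_coordinates)
  with cube have "compact ((\<Pi>\<^sub>E i\<in>(UNIV::nat set). {-1..1::real}) \<inter> C)"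
    by (rule compact_Int_closed)
  then have C: "compact C"
    using sub by (simp add: Int_absorb1)
  have "(\<lambda>i. if i = 0 then 1 else 0) \<in> C"
    using n by (auto simp: C_def if_distrib[of abs] sum.delta cong: if_cong)
  then have ne: "C \<noteq> {}"
    by auto
  have "continuous_on C q"
    unfolding q_def
    by (intro continuous_intros continuous_on_subset[OF continuous_on_product_coordinates subset_UNIV])
  then obtain f0 where f0: "f0 \<in> C" and min: "\<And>f. f \<in> C \<Longrightarrow> q f0 \<le> q f"
    using continuous_attains_inf[OF C ne] by blast
  have q_ip: "ip x x = q (Poly_Mapping.lookup x)" if "x \<in> Rn n" for x
    using ip_expand[OF ip that that] by (simp add: q_def)
  define m where "m = q f0"
  have m: "0 < m"
  proof -
    define x0 where "x0 = (\<Sum>i<n. Poly_Mapping.single i (f0 i))"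
    have x0: "x0 \<in> Rn n" and l: "Poly_Mapping.lookup x0 = f0"
      using f0 by (auto simp: x0_def emb_mem_Rn lookup_emb C_def fun_eq_iff)
    have "x0 \<noteq> 0"
      using f0 l by (auto simp: C_def)
    then have "0 < ip x0 x0"
      by (rule inner_product_onD(4)[OF ip x0])
    then show ?thesis
      by (simp add: q_ip[OF x0] l m_def)
  qed
  show ?thesis
  proof (rule that)
    show "0 \<le> 1 / sqrt m"
      using m by simp
    show "unit_ball n ip \<subseteq> {x \<in> Rn n. \<forall>i<n. \<bar>Poly_Mapping.lookup x i\<bar> \<le> 1 / sqrt m}"
    proof safe
      fix x assume "x \<in> unit_ball n ip"
      then have x: "x \<in> Rn n" and le: "ip x x \<le> 1"
        by (auto simp: unit_ball_def enorm_def)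
      then show "x \<in> Rn n" by simp
      define s where "s = (\<Sum>i<n. \<bar>Poly_Mapping.lookup x i\<bar>)"
      fix i assume "i < n"
      then have i: "\<bar>Poly_Mapping.lookup x i\<bar> \<le> s"
        unfolding s_def by (intro member_le_sum) auto
      have "s \<le> 1 / sqrt m"
      proof (cases "s \<le> 0")
        case False
        then have s: "0 < s" by simp
        have "(\<lambda>i. Poly_Mapping.lookup x i / s) \<in> C"
          using x s by (auto simp: C_def mem_Rn sum_divide_distrib[symmetric] s_def[symmetric])
        then have "m \<le> q (\<lambda>i. Poly_Mapping.lookup x i / s)"
          unfolding m_def by (rule min)
        also have "\<dots> = ip x x / s\<^sup>2"
          unfolding q_ip[OF x] q_def by (simp add: sum_divide_distrib power2_eq_square)
        also have "\<dots> \<le> 1 / s\<^sup>2"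
          using le by (simp add: divide_right_mono)
        finally have "m * s\<^sup>2 \<le> 1"
          using s by (simp add: field_simps)
        then have "s\<^sup>2 \<le> 1 / m"
          using m by (simp add: field_simps)
        then have "s \<le> sqrt (1 / m)"
          by (rule real_le_rsqrt)
        then show ?thesis
          by (simp add: real_sqrt_divide)
      next
        case True
        moreover have "0 \<le> 1 / sqrt m" using m by simp
        ultimately show ?thesis by linarith
      qed
      with i show "\<bar>Poly_Mapping.lookup x i\<bar> \<le> 1 / sqrt m"
        by simp
    qed
  qed
qed

lemma emeasure_unit_ball:
  assumes ip: "inner_product_on n ip" and n: "0 < n"
  shows "emeasure (lebesgue_Rn n) (unit_ball n ip) \<noteq> 0" "emeasure (lebesgue_Rn n) (unit_ball n ip) \<noteq> \<infinity>"
proof -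
  obtain r where r: "0 < r" "{x \<in> Rn n. \<forall>i<n. \<bar>Poly_Mapping.lookup x i\<bar> \<le> r} \<subseteq> unit_ball n ip"
    using cube_subset_unit_ball[OF ip] .
  have "0 < ennreal (2 * r) ^ n"
    using r by (simp add: ennreal_power)
  also have "\<dots> \<le> emeasure (lebesgue_Rn n) (unit_ball n ip)"
    using r sets_unit_ball(1)[OF ip] by (subst emeasure_cube(2)[symmetric]) (auto intro!: emeasure_mono simp: sets_lebesgue_Rn)
  finally show "emeasure (lebesgue_Rn n) (unit_ball n ip) \<noteq> 0"
    by simp
  obtain R where R: "0 \<le> R" "unit_ball n ip \<subseteq> {x \<in> Rn n. \<forall>i<n. \<bar>Poly_Mapping.lookup x i\<bar> \<le> R}"
    using unit_ball_subset_cube[OF ip n] .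
  have "emeasure (lebesgue_Rn n) (unit_ball n ip) \<le> ennreal (2 * R) ^ n"
    using R by (subst emeasure_cube(2)[symmetric]) (auto intro!: emeasure_mono emeasure_cube(1))
  also have "\<dots> < \<infinity>"
    using R by (simp add: ennreal_power)
  finally show "emeasure (lebesgue_Rn n) (unit_ball n ip) \<noteq> \<infinity>"
    by simp
qed

definition rotation_on :: "nat \<Rightarrow> ((nat \<Rightarrow>\<^sub>0 real) \<Rightarrow> (nat \<Rightarrow>\<^sub>0 real) \<Rightarrow> real) \<Rightarrow> ((nat \<Rightarrow>\<^sub>0 real) \<Rightarrow> (nat \<Rightarrow>\<^sub>0 real)) \<Rightarrow> bool" where
  "rotation_on n ip T \<longleftrightarrow>
     linear T \<and> T ` Rn n = Rn n \<and> (\<forall>x\<in>Rn n. \<forall>y\<in>Rn n. ip (T x) (T y) = ip x y)"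

lemma rotation_on_enorm:
  "rotation_on n ip T \<Longrightarrow> x \<in> Rn n \<Longrightarrow> enorm ip (T x) = enorm ip x"
  by (simp add: rotation_on_def enorm_def)

lemma measurable_linear_on_Rn:
  assumes v: "\<And>i. i < n \<Longrightarrow> v i \<in> Rn n"
  shows "(\<lambda>x. \<Sum>i<n. Poly_Mapping.lookup x i *\<^sub>R v i) \<in> borel_Rn n \<rightarrow>\<^sub>M borel_Rn n"
proof (rule measurable_into_Rn)
  fix j
  show "(\<lambda>x. Poly_Mapping.lookup (\<Sum>i<n. Poly_Mapping.lookup x i *\<^sub>R v i) j) \<in> borel_measurable (borel_Rn n)"
    unfolding lookup_sum lookup_scaleR real_scaleR_def using measurable_lookup by measurable
qed (use v in \<open>auto intro!: subspace_sum[OF subspace_Rn] subspace_scale[OF subspace_Rn]\<close>)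

lemma linear_expand:
  assumes "linear T" "x \<in> Rn n"
  shows "T x = (\<Sum>i<n. Poly_Mapping.lookup x i *\<^sub>R T (std_vec i))"
proof -
  have "T x = T (\<Sum>i<n. Poly_Mapping.lookup x i *\<^sub>R std_vec i)"
    using assms(2) by (simp add: Rn_expand[symmetric])
  then show ?thesis
    by (simp add: linear_sum[OF assms(1)] linear_scale[OF assms(1)])
qed

lemma measurable_rotation:
  assumes "rotation_on n ip T"
  shows "T \<in> borel_Rn n \<rightarrow>\<^sub>M borel_Rn n"
proof -
  have T: "linear T" "\<And>x. x \<in> Rn n \<Longrightarrow> T x \<in> Rn n"
    using assms by (auto simp: rotation_on_def)
  have "(\<lambda>x. \<Sum>i<n. Poly_Mapping.lookup x i *\<^sub>R T (std_vec i)) \<in> borel_Rn n \<rightarrow>\<^sub>M borel_Rn n"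
    using T by (intro measurable_linear_on_Rn) (auto simp: std_vec_mem_Rn)
  then show ?thesis
    by (rule measurable_cong[THEN iffD1, rotated]) (simp add: linear_expand[OF T(1), symmetric])
qed

lemma distr_lebesgue_Rn_rotation:
  assumes ip: "inner_product_on n ip" and n: "0 < n" and rot: "rotation_on n ip T"
  shows "distr (lebesgue_Rn n) (borel_Rn n) T = lebesgue_Rn n"
proof -
  let ?L = "lebesgue_Rn n" and ?M = "borel_Rn n" and ?D = "unit_ball n ip"
  let ?\<nu> = "distr ?L ?M T"
  have lin: "linear T" and TRn: "T ` Rn n = Rn n"
    and iso: "\<And>x y. x \<in> Rn n \<Longrightarrow> y \<in> Rn n \<Longrightarrow> ip (T x) (T y) = ip x y"
    using rot by (auto simp: rotation_on_def)
  have T_mem: "T x \<in> Rn n" if "x \<in> Rn n" for x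
    using TRn that by blast
  have T_meas: "T \<in> ?M \<rightarrow>\<^sub>M ?M"
    by (rule measurable_rotation[OF rot])
  then have T_meas': "T \<in> ?L \<rightarrow>\<^sub>M ?M"
    by (simp cong: measurable_cong_sets add: sets_lebesgue_Rn)
  have inj: "inj_on T (Rn n)"
  proof (rule inj_onI)
    fix x y assume x: "x \<in> Rn n" and y: "y \<in> Rn n" and eq: "T x = T y"
    then have d: "x - y \<in> Rn n"
      by (simp add: subspace_diff[OF subspace_Rn])
    have "T (x - y) = T (0 *\<^sub>R (x - y))"
      by (simp add: linear_diff[OF lin] linear_scale[OF lin] eq linear_0[OF lin])
    then have "ip (x - y) (x - y) = ip (0 *\<^sub>R (x - y)) (x - y)"
      using iso[of "x - y" "x - y"] iso[of "0 *\<^sub>R (x - y)" "x - y"] d subspace_0[OF subspace_Rn]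
      by simp
    also have "\<dots> = 0 * ip (x - y) (x - y)"
      by (rule inner_product_onD(3)[OF ip d d])
    finally have "\<not> 0 < ip (x - y) (x - y)" by simp
    then have "x - y = 0"
      using inner_product_onD(4)[OF ip d] by blast
    then show "x = y" by simp
  qed
  define S where "S = (\<lambda>y. \<Sum>i<n. Poly_Mapping.lookup y i *\<^sub>R inv_into (Rn n) T (std_vec i))"
  have inv: "inv_into (Rn n) T (std_vec i) \<in> Rn n" "T (inv_into (Rn n) T (std_vec i)) = std_vec i"
    if "i < n" for i
    using that std_vec_mem_Rn[OF that] by (auto simp: TRn inv_into_into f_inv_into_f)
  have S_meas: "S \<in> ?M \<rightarrow>\<^sub>M ?M"
    unfolding S_def by (rule measurable_linear_on_Rn) (rule inv(1))
  have S_mem: "S y \<in> Rn n" for y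
    unfolding S_def using inv by (auto intro!: subspace_sum[OF subspace_Rn] subspace_scale[OF subspace_Rn])
  have TS: "T (S y) = y" if "y \<in> Rn n" for y
    unfolding S_def linear_sum[OF lin] linear_scale[OF lin]
    using that by (simp add: inv Rn_expand[symmetric])
  have ST: "S (T x) = x" if "x \<in> Rn n" for x
    using inj TS[OF T_mem[OF that]] that S_mem[of "T x"] by (auto dest: inj_onD)
  have sets_nu: "sets ?\<nu> = sets ?M"
    by simp
  have sf: "sigma_finite_measure ?\<nu>"
  proof (rule sigma_finite_measure_distr)
    show "S \<in> ?\<nu> \<rightarrow>\<^sub>M ?M"
      using S_meas by (simp cong: measurable_cong_sets)
    have "distr ?\<nu> ?M S = distr ?L ?M (\<lambda>x. x)"
      by (subst distr_distr[OF S_meas T_meas'], intro distr_cong refl) (simp add: ST)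
    also have "\<dots> = ?L"
      by (rule distr_id2) (simp add: sets_lebesgue_Rn)
    finally show "sigma_finite_measure (distr ?\<nu> ?M S)"
      by (simp add: sigma_finite_lebesgue_Rn)
  qed
  have shift_meas: "(\<lambda>x. x + b) \<in> ?M \<rightarrow>\<^sub>M ?M" if "b \<in> Rn n" for b
    using that by (auto intro!: measurable_Rn_add)
  have inv_nu: "distr ?\<nu> ?M (\<lambda>x. x + a) = ?\<nu>" if a: "a \<in> Rn n" for a
  proof -
    have shift': "(\<lambda>x. x + S a) \<in> ?L \<rightarrow>\<^sub>M ?M"
      using shift_meas[OF S_mem] by (simp cong: measurable_cong_sets add: sets_lebesgue_Rn)
    have "distr ?\<nu> ?M (\<lambda>x. x + a) = distr ?L ?M (\<lambda>x. T (x + S a))"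
      by (subst distr_distr[OF shift_meas[OF a] T_meas'], intro distr_cong refl)
         (simp add: linear_add[OF lin] TS a)
    also have "\<dots> = distr (distr ?L ?M (\<lambda>x. x + S a)) ?M T"
      by (subst distr_distr[OF T_meas shift']) (simp add: o_def)
    also have "\<dots> = ?\<nu>"
      by (simp add: translation_lebesgue_Rn[OF S_mem])
    finally show ?thesis .
  qed
  have D: "?D \<in> sets ?M"
    by (rule sets_unit_ball[OF ip])
  have "T -` ?D \<inter> Rn n = ?D"
    using rotation_on_enorm[OF rot] T_mem by (auto simp: unit_ball_def)
  then have nu_D: "emeasure ?\<nu> ?D = emeasure ?L ?D"
    using emeasure_distr[OF T_meas' D] by simp
  show ?thesis
  proof (rule measure_eqI)
    show "sets ?\<nu> = sets ?L"
      by (simp add: sets_lebesgue_Rn)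
    fix A assume "A \<in> sets ?\<nu>"
    then have A: "A \<in> sets ?M" by simp
    have "emeasure ?L ?D * emeasure ?\<nu> A = emeasure ?L ?D * emeasure ?L A"
      using translation_invariant_proportional[OF sets_nu sf inv_nu A D] nu_D
      by (simp add: mult.commute)
    then show "emeasure ?\<nu> A = emeasure ?L A"
      using emeasure_unit_ball[OF ip n] by (simp add: ennreal_mult_cancel_left)
  qed
qed

text \<open>Hence \<^term>\<open>sphere_measure n ip\<close> is a probability measure on the sphere, invariant under
  all rotations.\<close>

lemma space_sphere_measure:
  assumes "inner_product_on n ip"
  shows "space (sphere_measure n ip) = unit_sphere n ip"
    and "sets (sphere_measure n ip) = sets (restrict_space borel (unit_sphere n ip))"
proof -
  have sub: "unit_sphere n ip \<subseteq> Rn n"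
    by (auto simp: unit_sphere_def)
  then show "space (sphere_measure n ip) = unit_sphere n ip"
    by (auto simp: sphere_measure_def space_restrict_space)
  have "sets (sphere_measure n ip) = sets (restrict_space (borel_Rn n) (unit_sphere n ip))"
    unfolding sphere_measure_def by (intro sets_restrict_space_cong) simp
  also have "\<dots> = sets (restrict_space borel (unit_sphere n ip))"
    using sub by (simp add: sets_restrict_restrict_space Int_absorb1)
  finally show "sets (sphere_measure n ip) = sets (restrict_space borel (unit_sphere n ip))" .
qed

lemma measurable_normalize:
  assumes "inner_product_on n ip"
  shows "(\<lambda>x. x /\<^sub>R enorm ip x) \<in> borel_Rn n \<rightarrow>\<^sub>M borel_Rn n"
proof (rule measurable_into_Rn)
  note [measurable] = measurable_enorm[OF assms] measurable_lookup
  show "(\<lambda>x. Poly_Mapping.lookup (x /\<^sub>R enorm ip x) i) \<in> borel_measurable (borel_Rn n)" for i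
    unfolding lookup_scaleR real_scaleR_def by measurable
qed (auto intro!: subspace_scale[OF subspace_Rn])

lemma sets_sphere_measureD:
  assumes "inner_product_on n ip" "A \<in> sets (sphere_measure n ip)"
  shows "A \<in> sets (borel_Rn n)" "A \<subseteq> unit_sphere n ip"
proof -
  have "unit_sphere n ip \<inter> Rn n = unit_sphere n ip"
    by (auto simp: unit_sphere_def)
  with assms sets_unit_ball(2)[OF assms(1)]
  show "A \<in> sets (borel_Rn n)" "A \<subseteq> unit_sphere n ip"
    unfolding sphere_measure_def by (auto simp: sets_restrict_space_iff)
qed

lemma emeasure_sphere_measure:
  assumes ip: "inner_product_on n ip" and A: "A \<in> sets (sphere_measure n ip)"
  shows "emeasure (sphere_measure n ip) A =
    emeasure (lebesgue_Rn n) {x \<in> unit_ball n ip. x /\<^sub>R enorm ip x \<in> A} / emeasure (lebesgue_Rn n) (unit_ball n ip)"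
proof -
  let ?f = "\<lambda>x. x /\<^sub>R enorm ip x" and ?U = "uniform_measure (lebesgue_Rn n) (unit_ball n ip)"
  have A': "A \<in> sets (borel_Rn n)" "A \<subseteq> unit_sphere n ip"
    using sets_sphere_measureD[OF ip A] by auto
  have f: "?f \<in> borel_Rn n \<rightarrow>\<^sub>M borel_Rn n"
    by (rule measurable_normalize[OF ip])
  then have f': "?f \<in> ?U \<rightarrow>\<^sub>M borel_Rn n"
    by (simp cong: measurable_cong_sets add: sets_lebesgue_Rn)
  have "emeasure (sphere_measure n ip) A = emeasure (distr ?U (borel_Rn n) ?f) A"
    unfolding sphere_measure_def
    using A' sets_unit_ball(2)[OF ip] by (subst emeasure_restrict_space) (auto simp: Int_absorb2 unit_sphere_def)
  also have "\<dots> = emeasure ?U (?f -` A \<inter> Rn n)"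
    using A' f' by (subst emeasure_distr) auto
  also have "\<dots> = emeasure (lebesgue_Rn n) (unit_ball n ip \<inter> (?f -` A \<inter> Rn n)) / emeasure (lebesgue_Rn n) (unit_ball n ip)"
    using measurable_sets[OF f A'(1)] sets_unit_ball(1)[OF ip]
    by (subst emeasure_uniform_measure) (auto simp: sets_lebesgue_Rn)
  also have "unit_ball n ip \<inter> (?f -` A \<inter> Rn n) = {x \<in> unit_ball n ip. ?f x \<in> A}"
    by (auto simp: unit_ball_def)
  finally show ?thesis .
qed

lemma sphere_measure_normalized:
  assumes ip: "inner_product_on n ip" and n: "0 < n"
  shows "emeasure (sphere_measure n ip) (unit_sphere n ip) = 1"
proof -
  let ?L = "lebesgue_Rn n" and ?D = "unit_ball n ip"
  have "{x \<in> Rn n. \<forall>i<n. \<bar>Poly_Mapping.lookup x i\<bar> \<le> 0} = {0}"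
    using subspace_0[OF subspace_Rn] by (auto intro!: poly_mapping_eqI simp: mem_Rn) (metis not_less)
  then have zero: "emeasure ?L {0} = 0" "{0} \<in> sets ?L"
    using emeasure_cube[of 0 n] n by (auto simp: power_0_left)
  have D: "?D \<in> sets ?L"
    using sets_unit_ball(1)[OF ip] by (simp add: sets_lebesgue_Rn)
  have mem: "x /\<^sub>R enorm ip x \<in> unit_sphere n ip \<longleftrightarrow> x \<noteq> 0" if x: "x \<in> Rn n" for x
  proof
    assume "x /\<^sub>R enorm ip x \<in> unit_sphere n ip"
    then show "x \<noteq> 0"
      using ip_expand[OF ip, of 0 0] subspace_0[OF subspace_Rn, of n] by (auto simp: unit_sphere_def enorm_def)
  next
    assume "x \<noteq> 0"
    then have pos: "0 < ip x x"
      by (rule inner_product_onD(4)[OF ip x])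
    let ?e = "enorm ip x"
    have e: "0 < ?e" "?e * ?e = ip x x"
      using pos by (auto simp: enorm_def)
    have m: "x /\<^sub>R ?e \<in> Rn n"
      by (rule subspace_scale[OF subspace_Rn x])
    have "ip (x /\<^sub>R ?e) (x /\<^sub>R ?e) = inverse ?e * ip x (x /\<^sub>R ?e)"
      by (rule inner_product_onD(3)[OF ip x m])
    also have "ip x (x /\<^sub>R ?e) = ip (x /\<^sub>R ?e) x"
      by (rule inner_product_onD(1)[OF ip x m])
    also have "\<dots> = inverse ?e * ip x x"
      by (rule inner_product_onD(3)[OF ip x x])
    finally have "ip (x /\<^sub>R ?e) (x /\<^sub>R ?e) = 1"
      using e pos by (simp add: field_simps)
    then show "x /\<^sub>R ?e \<in> unit_sphere n ip"
      using m unfolding unit_sphere_def by (simp add: enorm_def)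
  qed
  have "{x \<in> ?D. x /\<^sub>R enorm ip x \<in> unit_sphere n ip} = ?D - {0}"
    using mem by (auto simp: unit_ball_def)
  moreover have "emeasure ?L (?D - {0}) = emeasure ?L ?D"
    using zero D by (intro emeasure_Diff_null_set) (auto intro: null_setsI)
  moreover have "unit_sphere n ip \<in> sets (sphere_measure n ip)"
    using sets.top[of "sphere_measure n ip"] by (simp add: space_sphere_measure[OF ip])
  ultimately show ?thesis
    using emeasure_unit_ball[OF ip n] by (simp add: emeasure_sphere_measure[OF ip] ennreal_divide_self less_top)
qed

lemma sphere_measure_rotation_invariant:
  assumes ip: "inner_product_on n ip" and n: "0 < n" and rot: "rotation_on n ip T"
  shows "distr (sphere_measure n ip) (sphere_measure n ip) T = sphere_measure n ip"
proof (rule measure_eqI)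
  let ?L = "lebesgue_Rn n" and ?M = "borel_Rn n" and ?D = "unit_ball n ip" and ?\<sigma> = "sphere_measure n ip"
  let ?f = "\<lambda>x. x /\<^sub>R enorm ip x"
  have lin: "linear T" and T_mem: "\<And>x. x \<in> Rn n \<Longrightarrow> T x \<in> Rn n"
    using rot by (auto simp: rotation_on_def)
  have T_meas: "T \<in> ?M \<rightarrow>\<^sub>M ?M"
    by (rule measurable_rotation[OF rot])
  then have T_meas': "T \<in> ?L \<rightarrow>\<^sub>M ?M"
    by (simp cong: measurable_cong_sets add: sets_lebesgue_Rn)
  have "T \<in> restrict_space ?M (unit_sphere n ip) \<rightarrow>\<^sub>M restrict_space ?M (unit_sphere n ip)"
    using T_mem rotation_on_enorm[OF rot]
    by (intro measurable_restrict_space2 measurable_restrict_space1[OF T_meas]) (auto simp: unit_sphere_def space_restrict_space)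
  moreover have "sets ?\<sigma> = sets (restrict_space ?M (unit_sphere n ip))"
    unfolding sphere_measure_def by (intro sets_restrict_space_cong) simp
  ultimately have T_sphere: "T \<in> ?\<sigma> \<rightarrow>\<^sub>M ?\<sigma>"
    by (simp cong: measurable_cong_sets)
  fix A assume "A \<in> sets (distr ?\<sigma> ?\<sigma> T)"
  then have A: "A \<in> sets ?\<sigma>" by simp
  let ?C = "{x \<in> ?D. ?f x \<in> A}"
  have "?C = ?D \<inter> (?f -` A \<inter> Rn n)"
    by (auto simp: unit_ball_def)
  then have C: "?C \<in> sets ?M"
    using measurable_sets[OF measurable_normalize[OF ip] sets_sphere_measureD(1)[OF ip A]] sets_unit_ball(1)[OF ip]
    by auto
  have pre: "T -` A \<inter> space ?\<sigma> \<in> sets ?\<sigma>"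
    by (rule measurable_sets[OF T_sphere A])
  have sphere_iff: "?f x \<in> unit_sphere n ip \<longleftrightarrow> ?f (T x) \<in> unit_sphere n ip" if "x \<in> Rn n" for x
  proof -
    have "?f (T x) = T (?f x)" "?f x \<in> Rn n"
      using that by (simp_all add: linear_scale[OF lin] rotation_on_enorm[OF rot] subspace_scale[OF subspace_Rn])
    then show ?thesis
      using T_mem rotation_on_enorm[OF rot] by (auto simp: unit_sphere_def)
  qed
  have "{x \<in> ?D. ?f x \<in> T -` A \<inter> space ?\<sigma>} = T -` ?C \<inter> Rn n"
    using T_mem rotation_on_enorm[OF rot] sets_sphere_measureD(2)[OF ip A] sphere_iff
    by (auto simp: unit_ball_def space_sphere_measure[OF ip] linear_scale[OF lin])
  moreover have "emeasure ?L (T -` ?C \<inter> Rn n) = emeasure ?L ?C"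
    using emeasure_distr[OF T_meas' C] by (simp add: distr_lebesgue_Rn_rotation[OF ip n rot])
  ultimately show "emeasure (distr ?\<sigma> ?\<sigma> T) A = emeasure ?\<sigma> A"
    using pre A by (simp add: emeasure_distr[OF T_sphere A] emeasure_sphere_measure[OF ip])
qed simp

end

(*
  Write mu = 1 - l, M for the mean gauge of K and |.| for the Euclidean norm.

  By Markov's inequality on the sphere, D inter 3 M K has at least half the volume of D. A volume
  comparison with this symmetric set shows that D is covered by at most 4 exp (mu^2 n / 32) translates
  x + t K with x in D and t = 12 * 2^(1/p) M / mu.

  The kernel of P is spanned by directions chosen one after the other. Let V be an orthonormal basis of
  the complement of the directions chosen so far. A uniformly random normalized combination of V with
  signs as coefficients decreases, on average, the sum over the centres x of |P x|^(2n) by the factor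
  5/6, by the second and fourth moments of a Rademacher sum. After n - [l n] steps this gain beats the
  number of centres, so that |P x| <= r = exp (- mu / 24) for every centre.

  Hence P D is contained in r P D + t P K. As P K is p-convex, iterating this inclusion gives
  P D inside B P K for every B with B^p > t^p / (1 - r^p).
*)
theory Submission
  imports Defs
begin

subsection \<open>Orthonormal systems\<close>

text \<open>For \<open>p < 1\<close> neither separation nor polarity is available, so the inclusion
  is not obtained by duality but by self-improvement. A ratio \<open>r\<close> barely below 1 is
  enough for that: \<open>1 - r powr p\<close> is of order \<open>p * \<mu>\<close>, and its
  \<open>p\<close>-th root produces the exponent \<open>1 / p\<close> of \<open>1 - l\<close> and a
  factor of order \<open>(1 / p) powr (1 / p)\<close>. The remaining exponent 1 of
  \<open>1 - l\<close> comes from the mesh, as \<open>t\<close> is proportional to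
  \<open>1 / \<mu>\<close>. The factor \<open>2 powr (1 / p)\<close> is the price of differences of
  points of \<open>K\<close>.

  Averaging over sign patterns involves finite sums only, so neither a measure on subspaces nor
  concentration of measure enters; a pattern that does at least as well as the average is then
  fixed. A direction drawn from a \<open>k\<close>-dimensional complement removes on average only
  the fraction \<open>1 / k\<close> of a squared length. The \<open>n\<close>-th power of squared
  lengths, with \<open>n \<ge> k\<close>, turns this into a constant factor per step. The same power
  lets a bound on the sum over all centres control each centre, since the number of centres enters
  only through its \<open>n\<close>-th root.\<close>

locale euclidean_Rn =
  fixes n :: nat and ip :: "(nat \<Rightarrow>\<^sub>0 real) \<Rightarrow> (nat \<Rightarrow>\<^sub>0 real) \<Rightarrow> real"
  assumes ip: "inner_product_on n ip"
begin

lemma Rn_closed [simp, intro]: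
  "0 \<in> Rn n"
  "x \<in> Rn n \<Longrightarrow> y \<in> Rn n \<Longrightarrow> x + y \<in> Rn n"
  "x \<in> Rn n \<Longrightarrow> y \<in> Rn n \<Longrightarrow> x - y \<in> Rn n"
  "x \<in> Rn n \<Longrightarrow> c *\<^sub>R x \<in> Rn n"
  "x \<in> Rn n \<Longrightarrow> - x \<in> Rn n"
  using subspace_Rn[of n]
  by (auto intro: subspace_0 subspace_add subspace_diff subspace_scale subspace_neg)

lemma Rn_sum_closed [intro]: "(\<And>i. i \<in> A \<Longrightarrow> f i \<in> Rn n) \<Longrightarrow> sum f A \<in> Rn n"
  by (rule subspace_sum[OF subspace_Rn])

lemma ip_commute: "x \<in> Rn n \<Longrightarrow> y \<in> Rn n \<Longrightarrow> ip x y = ip y x"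
  by (rule inner_product_onD(1)[OF ip])

lemma ip_add_left: "x \<in> Rn n \<Longrightarrow> y \<in> Rn n \<Longrightarrow> z \<in> Rn n \<Longrightarrow> ip (x + y) z = ip x z + ip y z"
  by (rule inner_product_onD(2)[OF ip])

lemma ip_scale_left: "x \<in> Rn n \<Longrightarrow> y \<in> Rn n \<Longrightarrow> ip (c *\<^sub>R x) y = c * ip x y"
  by (rule inner_product_onD(3)[OF ip])

lemma ip_add_right: "x \<in> Rn n \<Longrightarrow> y \<in> Rn n \<Longrightarrow> z \<in> Rn n \<Longrightarrow> ip z (x + y) = ip z x + ip z y"
  using ip_add_left[of x y z] by (simp add: ip_commute[of z])

lemma ip_scale_right: "x \<in> Rn n \<Longrightarrow> y \<in> Rn n \<Longrightarrow> ip y (c *\<^sub>R x) = c * ip y x"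
  using ip_scale_left[of x y c] by (simp add: ip_commute[of y])

lemma ip_diff_left: "x \<in> Rn n \<Longrightarrow> y \<in> Rn n \<Longrightarrow> z \<in> Rn n \<Longrightarrow> ip (x - y) z = ip x z - ip y z"
  using ip_add_left[of x "(-1) *\<^sub>R y" z] ip_scale_left[of y z "-1"] by simp

lemma ip_zero_left [simp]: "y \<in> Rn n \<Longrightarrow> ip 0 y = 0"
  using ip_scale_left[of 0 y 0] by simp

lemma ip_lincomb_left:
  "finite A \<Longrightarrow> (\<And>i. i \<in> A \<Longrightarrow> v i \<in> Rn n) \<Longrightarrow> y \<in> Rn n \<Longrightarrow>
    ip (\<Sum>i\<in>A. a i *\<^sub>R v i) y = (\<Sum>i\<in>A. a i * ip (v i) y)"
  by (rule ip_sum_left[OF ip])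

lemma ip_lincomb_right:
  "finite A \<Longrightarrow> (\<And>i. i \<in> A \<Longrightarrow> v i \<in> Rn n) \<Longrightarrow> y \<in> Rn n \<Longrightarrow>
    ip y (\<Sum>i\<in>A. a i *\<^sub>R v i) = (\<Sum>i\<in>A. a i * ip y (v i))"
  using ip_lincomb_left[of A v y a] by (simp add: ip_commute[of y] Rn_sum_closed)

lemma ip_self_pos: "x \<in> Rn n \<Longrightarrow> x \<noteq> 0 \<Longrightarrow> 0 < ip x x"
  by (rule inner_product_onD(4)[OF ip])

lemma ip_self_nonneg: "x \<in> Rn n \<Longrightarrow> 0 \<le> ip x x"
  using ip_self_pos[of x] by (cases "x = 0") auto

lemma enorm_sq: "x \<in> Rn n \<Longrightarrow> (enorm ip x)\<^sup>2 = ip x x"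
  by (simp add: enorm_def ip_self_nonneg)

lemma enorm_scale: "x \<in> Rn n \<Longrightarrow> enorm ip (c *\<^sub>R x) = \<bar>c\<bar> * enorm ip x"
  by (simp add: enorm_def ip_scale_left ip_scale_right real_sqrt_mult flip: mult.assoc)

lemma enorm_uminus: "x \<in> Rn n \<Longrightarrow> enorm ip (- x) = enorm ip x"
  using enorm_scale[of x "-1"] by simp

lemma enorm_pos: "x \<in> Rn n \<Longrightarrow> x \<noteq> 0 \<Longrightarrow> 0 < enorm ip x"
  by (simp add: enorm_def ip_self_pos)

lemma mem_unit_ball: "x \<in> unit_ball n ip \<longleftrightarrow> x \<in> Rn n \<and> ip x x \<le> 1"
  by (auto simp: unit_ball_def enorm_def)

definition orthonormal :: "(nat \<Rightarrow>\<^sub>0 real) set \<Rightarrow> bool" where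
  "orthonormal U \<longleftrightarrow> finite U \<and> U \<subseteq> Rn n \<and>
     (\<forall>u\<in>U. \<forall>v\<in>U. ip u v = (if u = v then 1 else 0))"

lemma orthonormalD:
  assumes "orthonormal U"
  shows "finite U" "u \<in> U \<Longrightarrow> u \<in> Rn n" "u \<in> U \<Longrightarrow> v \<in> U \<Longrightarrow> ip u v = (if u = v then 1 else 0)"
  using assms by (auto simp: orthonormal_def)

lemma orthonormal_subset: "orthonormal U \<Longrightarrow> V \<subseteq> U \<Longrightarrow> orthonormal V"
  unfolding orthonormal_def by (meson finite_subset order_trans subsetD)

lemma ip_orthonormal_lincomb:
  assumes "orthonormal U" "v \<in> U"
  shows "ip (\<Sum>u\<in>U. a u *\<^sub>R u) v = a v"
proof -
  have "ip (\<Sum>u\<in>U. a u *\<^sub>R u) v = (\<Sum>u\<in>U. a u * ip u v)"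
    using orthonormalD[OF assms(1)] assms(2) by (intro ip_lincomb_left) auto
  also have "\<dots> = (\<Sum>u\<in>U. if u = v then a u else 0)"
    using orthonormalD[OF assms(1)] assms(2) by (intro sum.cong) auto
  finally show ?thesis
    using orthonormalD(1)[OF assms(1)] assms(2) by simp
qed

lemma ip_self_orthonormal_lincomb:
  assumes "orthonormal U"
  shows "ip (\<Sum>u\<in>U. a u *\<^sub>R u) (\<Sum>u\<in>U. a u *\<^sub>R u) = (\<Sum>u\<in>U. (a u)\<^sup>2)"
proof -
  have "(\<Sum>u\<in>U. a u *\<^sub>R u) \<in> Rn n"
    using orthonormalD[OF assms] by auto
  then have "ip (\<Sum>u\<in>U. a u *\<^sub>R u) (\<Sum>u\<in>U. a u *\<^sub>R u) = (\<Sum>u\<in>U. a u * ip (\<Sum>u\<in>U. a u *\<^sub>R u) u)"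
    using orthonormalD[OF assms] by (intro ip_lincomb_right) auto
  also have "\<dots> = (\<Sum>u\<in>U. (a u)\<^sup>2)"
    by (intro sum.cong refl) (simp add: ip_orthonormal_lincomb[OF assms] power2_eq_square)
  finally show ?thesis .
qed

lemma orthonormal_independent:
  assumes "orthonormal U"
  shows "independent U"
proof (rule independent_if_scalars_zero)
  show "finite U" using orthonormalD[OF assms] by auto
  fix f x assume "(\<Sum>x\<in>U. f x *\<^sub>R x) = 0" "x \<in> U"
  then show "f x = 0"
    using ip_orthonormal_lincomb[OF assms, of x f] orthonormalD[OF assms] by simp
qed

lemma independent_std_vecs: "independent (std_vec ` {..<n})"
proof (rule independent_if_scalars_zero)
  fix f x assume eq: "(\<Sum>x\<in>std_vec ` {..<n}. f x *\<^sub>R x) = 0" and "x \<in> std_vec ` {..<n}"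
  then obtain i where i: "i < n" "x = std_vec i" by auto
  have "inj_on std_vec {..<n}"
    by (auto simp: inj_on_def poly_mapping_eq_iff lookup_single fun_eq_iff when_def split: if_splits)
  then have "(\<Sum>j<n. f (std_vec j) *\<^sub>R std_vec j) = 0"
    using eq by (simp add: sum.reindex o_def)
  then have "Poly_Mapping.lookup (\<Sum>j<n. Poly_Mapping.single j (f (std_vec j))) i = 0"
    by (simp add: single_eq_scaleR[symmetric])
  then show "f x = 0"
    using i by (simp add: lookup_emb)
qed auto

lemma span_std_vecs: "span (std_vec ` {..<n}) = Rn n"
proof
  show "span (std_vec ` {..<n}) \<subseteq> Rn n"
    by (rule span_minimal[OF _ subspace_Rn]) (auto simp: std_vec_mem_Rn)
  show "Rn n \<subseteq> span (std_vec ` {..<n})"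
  proof
    fix x assume "x \<in> Rn n"
    then have "x = (\<Sum>i<n. Poly_Mapping.lookup x i *\<^sub>R std_vec i)" by (rule Rn_expand)
    also have "\<dots> \<in> span (std_vec ` {..<n})"
      by (intro span_sum span_scale span_base) auto
    finally show "x \<in> span (std_vec ` {..<n})" .
  qed
qed

lemma card_std_vecs: "card (std_vec ` {..<n}) = n"
  by (subst card_image)
     (auto simp: inj_on_def poly_mapping_eq_iff lookup_single fun_eq_iff when_def split: if_splits)

lemma orthonormal_card_le:
  assumes "orthonormal U"
  shows "card U \<le> n"
  using independent_span_bound[of "std_vec ` {..<n}" U] orthonormalD[OF assms]
    orthonormal_independent[OF assms] span_std_vecs card_std_vecs by auto

text \<open>For orthonormal \<open>U\<close> this is the orthogonal projection onto the complement
  of \<open>U\<close>, but only on \<open>Rn n\<close>. Elsewhere \<open>ip\<close> is arbitrary and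
  the map need not be linear.\<close>

definition residual :: "(nat \<Rightarrow>\<^sub>0 real) set \<Rightarrow> (nat \<Rightarrow>\<^sub>0 real) \<Rightarrow> (nat \<Rightarrow>\<^sub>0 real)" where
  "residual U x = x - (\<Sum>u\<in>U. ip x u *\<^sub>R u)"

lemma residual_mem: "orthonormal U \<Longrightarrow> x \<in> Rn n \<Longrightarrow> residual U x \<in> Rn n"
  unfolding residual_def by (intro Rn_closed Rn_sum_closed) (auto dest: orthonormalD(2))

lemma residual_orthogonal:
  assumes U: "orthonormal U" and x: "x \<in> Rn n" and v: "v \<in> U"
  shows "ip (residual U x) v = 0"
proof -
  have "(\<Sum>u\<in>U. ip x u *\<^sub>R u) \<in> Rn n"
    using orthonormalD[OF U] by auto
  then show ?thesis
    unfolding residual_def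
    using orthonormalD[OF U] x v by (subst ip_diff_left) (auto simp: ip_orthonormal_lincomb[OF U])
qed

lemma ip_residual:
  assumes U: "orthonormal U" and x: "x \<in> Rn n" and y: "y \<in> Rn n"
  shows "ip (residual U x) y = ip x y - (\<Sum>u\<in>U. ip x u * ip y u)"
proof -
  have "(\<Sum>u\<in>U. ip x u *\<^sub>R u) \<in> Rn n"
    using orthonormalD[OF U] by auto
  moreover have "ip (\<Sum>u\<in>U. ip x u *\<^sub>R u) y = (\<Sum>u\<in>U. ip x u * ip u y)"
    using orthonormalD[OF U] y by (intro ip_lincomb_left) auto
  moreover have "\<dots> = (\<Sum>u\<in>U. ip x u * ip y u)"
    using orthonormalD(2)[OF U] y by (intro sum.cong) (auto simp: ip_commute)
  ultimately show ?thesis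
    unfolding residual_def using x y by (subst ip_diff_left) auto
qed

lemma residual_idem:
  assumes U: "orthonormal U" and x: "x \<in> Rn n"
  shows "residual U (residual U x) = residual U x"
  using residual_orthogonal[OF U x] unfolding residual_def[of U "residual U x"] by simp

lemma ip_residual_self:
  assumes U: "orthonormal U" and x: "x \<in> Rn n"
  shows "ip (residual U x) (residual U x) = ip x x - (\<Sum>u\<in>U. (ip x u)\<^sup>2)"
proof -
  have "ip (residual U x) (residual U x) = ip x (residual U x)"
    using residual_orthogonal[OF U x] ip_residual[OF U x residual_mem[OF U x]] by simp
  also have "\<dots> = ip (residual U x) x"
    by (intro ip_commute x residual_mem U)
  finally show ?thesis
    using ip_residual[OF U x x] by (simp add: power2_eq_square)
qed

lemma orthonormal_insert:
  assumes U: "orthonormal U" and v: "v \<in> Rn n" "ip v v = 1" "\<And>u. u \<in> U \<Longrightarrow> ip v u = 0"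
  shows "v \<notin> U" "orthonormal (insert v U)"
proof -
  show "v \<notin> U"
    using v by force
  have "ip u v = 0" if "u \<in> U" for u
    using v(3)[OF that] ip_commute[OF v(1) orthonormalD(2)[OF U that]] by simp
  with v(3) have "ip u w = (if u = w then 1 else 0)" if "u \<in> insert v U" "w \<in> insert v U" for u w
    using that v(2) orthonormalD(3)[OF U, of u w] \<open>v \<notin> U\<close> by auto
  then show "orthonormal (insert v U)"
    using v(1) orthonormalD(1,2)[OF U] unfolding orthonormal_def by blast
qed

text \<open>One Gram-Schmidt step: the new vector is the normalized residual.\<close>

lemma orthonormal_extend:
  assumes U: "orthonormal U" and x: "x \<in> Rn n" "residual U x \<noteq> 0"
  obtains v where "v \<notin> U" "orthonormal (insert v U)"
proof -
  let ?r = "residual U x"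
  let ?v = "?r /\<^sub>R enorm ip ?r"
  have r: "?r \<in> Rn n" by (rule residual_mem[OF U x(1)])
  have e: "0 < enorm ip ?r" by (rule enorm_pos[OF r x(2)])
  have "?v \<in> Rn n" using r by auto
  moreover have "ip ?v ?v = 1"
    using e r enorm_sq[OF r, symmetric] by (simp add: ip_scale_left ip_scale_right power2_eq_square field_simps)
  moreover have "ip ?v u = 0" if "u \<in> U" for u
    using residual_orthogonal[OF U x(1) that] orthonormalD(2)[OF U that] r by (simp add: ip_scale_left)
  ultimately show ?thesis
    using orthonormal_insert[OF U] that by blast
qed

lemma orthonormal_completion:
  assumes U: "orthonormal U"
  obtains V where "U \<inter> V = {}" "orthonormal (U \<union> V)" "card (U \<union> V) = n"
proof -
  have "\<exists>V. U \<inter> V = {} \<and> orthonormal (U \<union> V) \<and> card (U \<union> V) = n"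
    using U
  proof (induction "n - card U" arbitrary: U)
    case 0
    then show ?case
      using orthonormal_card_le[OF 0(2)] by (intro exI[of _ "{}"]) auto
  next
    case (Suc k)
    \<comment> \<open>Otherwise the \<open>n\<close> independent standard vectors would lie in the
      span of fewer than \<open>n\<close> vectors.\<close>
    have "\<not> Rn n \<subseteq> span U"
    proof
      assume "Rn n \<subseteq> span U"
      then have "std_vec ` {..<n} \<subseteq> span U"
        using std_vec_mem_Rn by auto
      then have "n \<le> card U"
        using independent_span_bound[of U "std_vec ` {..<n}"] orthonormalD(1)[OF Suc.prems]
          independent_std_vecs card_std_vecs by auto
      with Suc(2) show False by simp
    qed
    then obtain x where x: "x \<in> Rn n" "x \<notin> span U" by auto
    have "(\<Sum>u\<in>U. ip x u *\<^sub>R u) \<in> span U"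
      by (intro span_sum span_scale span_base)
    with x have "residual U x \<noteq> 0"
      by (auto simp: residual_def)
    then obtain v where v: "v \<notin> U" "orthonormal (insert v U)"
      using orthonormal_extend[OF Suc.prems x(1)] by blast
    have "k = n - card (insert v U)"
      using Suc(2) v(1) orthonormalD(1)[OF Suc.prems] by simp
    from Suc(1)[OF this v(2)] obtain V where
      "insert v U \<inter> V = {}" "orthonormal (insert v U \<union> V)" "card (insert v U \<union> V) = n" by blast
    with v show ?case
      by (intro exI[of _ "insert v V"]) auto
  qed
  then show ?thesis using that by blast
qed

text \<open>A nonzero residual could be normalized and added, giving \<open>n + 1\<close>
  orthonormal vectors.\<close>

lemma residual_complete:
  assumes B: "orthonormal B" "card B = n" and x: "x \<in> Rn n"
  shows "residual B x = 0"
proof (rule ccontr)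
  assume "residual B x \<noteq> 0"
  then obtain v where v: "v \<notin> B" "orthonormal (insert v B)"
    using orthonormal_extend[OF B(1) x] by blast
  then have "Suc n \<le> n"
    using orthonormal_card_le[OF v(2)] orthonormalD(1)[OF B(1)] B(2) by simp
  then show False by simp
qed

text \<open>Parseval in the complement of \<open>U\<close>. It turns residual lengths into sums of
  squared coordinates, to which the sign estimates apply.\<close>

lemma residual_eq_lincomb:
  assumes B: "orthonormal (U \<union> V)" "card (U \<union> V) = n" "U \<inter> V = {}" and x: "x \<in> Rn n"
  shows "residual U x = (\<Sum>v\<in>V. ip x v *\<^sub>R v)"
    and "ip (residual U x) (residual U x) = (\<Sum>v\<in>V. (ip x v)\<^sup>2)"
proof -
  have fin: "finite U" "finite V" using orthonormalD(1)[OF B(1)] by auto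
  have "x = (\<Sum>u\<in>U. ip x u *\<^sub>R u) + (\<Sum>v\<in>V. ip x v *\<^sub>R v)"
    using residual_complete[OF B(1,2) x] fin B(3) by (simp add: residual_def sum.union_disjoint)
  then have "x - (\<Sum>u\<in>U. ip x u *\<^sub>R u) = (\<Sum>v\<in>V. ip x v *\<^sub>R v)"
    by (simp only: diff_eq_eq add.commute)
  then show *: "residual U x = (\<Sum>v\<in>V. ip x v *\<^sub>R v)"
    unfolding residual_def .
  show "ip (residual U x) (residual U x) = (\<Sum>v\<in>V. (ip x v)\<^sup>2)"
    unfolding * by (rule ip_self_orthonormal_lincomb[OF orthonormal_subset[OF B(1)]]) auto
qed

end

subsection \<open>Random signs\<close>

text \<open>A Rademacher sum; \<open>S\<close> is the set of indices with sign \<open>+1\<close>.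
  Summing over \<open>Pow V\<close> is thus \<open>2 ^ card V\<close> times the expectation over
  independent signs.\<close>

definition signed_sum :: "('a \<Rightarrow> real) \<Rightarrow> 'a set \<Rightarrow> 'a set \<Rightarrow> real" where
  "signed_sum a V S = (\<Sum>v\<in>V. (if v \<in> S then 1 else -1) * a v)"

text \<open>Conditioning on the sign of \<open>v\<close>. A general \<open>F\<close> serves both
  moment computations.\<close>

lemma sum_Pow_insert:
  fixes F :: "real \<Rightarrow> real"
  assumes "finite V" "v \<notin> V"
  shows "(\<Sum>S\<in>Pow (insert v V). F (signed_sum a (insert v V) S)) =
    (\<Sum>S\<in>Pow V. F (signed_sum a V S - a v) + F (signed_sum a V S + a v))"
proof -
  have "signed_sum a (insert v V) S = signed_sum a V S - a v"
    "signed_sum a (insert v V) (insert v S) = signed_sum a V S + a v" if "S \<subseteq> V" for S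
  proof -
    have "v \<notin> S" using that assms by auto
    then show "signed_sum a (insert v V) S = signed_sum a V S - a v"
      using assms by (simp add: signed_sum_def)
    have "(\<Sum>u\<in>V. (if u \<in> insert v S then 1 else -1) * a u) = (\<Sum>u\<in>V. (if u \<in> S then 1 else -1) * a u)"
      using assms by (intro sum.cong) auto
    then show "signed_sum a (insert v V) (insert v S) = signed_sum a V S + a v"
      using assms by (simp add: signed_sum_def)
  qed
  moreover have "inj_on (insert v) (Pow V)"
    using assms by (auto simp: inj_on_def)
  moreover have "Pow V \<inter> insert v ` Pow V = {}"
    using assms by auto
  ultimately show ?thesis
    using assms by (simp add: Pow_insert sum.union_disjoint sum.reindex sum.distrib)
qed

lemma signed_sum_second_moment:
  assumes "finite V"
  shows "(\<Sum>S\<in>Pow V. (signed_sum a V S)\<^sup>2) = 2 ^ card V * (\<Sum>v\<in>V. (a v)\<^sup>2)"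
  using assms
proof (induction V)
  case empty
  then show ?case by (simp add: signed_sum_def)
next
  case (insert v V)
  have "(\<Sum>S\<in>Pow (insert v V). (signed_sum a (insert v V) S)\<^sup>2) =
      (\<Sum>S\<in>Pow V. (signed_sum a V S - a v)\<^sup>2 + (signed_sum a V S + a v)\<^sup>2)"
    by (rule sum_Pow_insert[OF insert(1,2), where F = "\<lambda>x. x\<^sup>2"])
  also have "\<dots> = (\<Sum>S\<in>Pow V. 2 * (signed_sum a V S)\<^sup>2 + 2 * (a v)\<^sup>2)"
    by (intro sum.cong refl) (simp add: power2_eq_square algebra_simps)
  also have "\<dots> = 2 * (2 ^ card V * (\<Sum>v\<in>V. (a v)\<^sup>2)) + 2 ^ card V * (2 * (a v)\<^sup>2)"
    using insert by (simp add: sum.distrib card_Pow flip: sum_distrib_left)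
  finally show ?case
    using insert by (simp add: algebra_simps)
qed

text \<open>Khintchine's inequality for the exponent 4, with the Gaussian constant 3.\<close>

lemma signed_sum_fourth_moment:
  assumes "finite V"
  shows "(\<Sum>S\<in>Pow V. (signed_sum a V S) ^ 4) \<le> 3 * 2 ^ card V * (\<Sum>v\<in>V. (a v)\<^sup>2)\<^sup>2"
  using assms
proof (induction V)
  case empty
  then show ?case by (simp add: signed_sum_def)
next
  case (insert v V)
  let ?A = "\<Sum>v\<in>V. (a v)\<^sup>2" and ?N = "2 ^ card V :: real"
  have "(\<Sum>S\<in>Pow (insert v V). (signed_sum a (insert v V) S) ^ 4) =
      (\<Sum>S\<in>Pow V. (signed_sum a V S - a v) ^ 4 + (signed_sum a V S + a v) ^ 4)"
    by (rule sum_Pow_insert[OF insert(1,2), where F = "\<lambda>x. x ^ 4"])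
  also have "\<dots> = (\<Sum>S\<in>Pow V. 2 * (signed_sum a V S) ^ 4 + 12 * (a v)\<^sup>2 * (signed_sum a V S)\<^sup>2 + 2 * (a v) ^ 4)"
    by (intro sum.cong refl) (simp add: power4_eq_xxxx power2_eq_square algebra_simps)
  also have "\<dots> = 2 * (\<Sum>S\<in>Pow V. (signed_sum a V S) ^ 4) + 12 * (a v)\<^sup>2 * (?N * ?A) + ?N * (2 * (a v) ^ 4)"
    using insert signed_sum_second_moment[OF insert(1), of a]
    by (simp add: sum.distrib card_Pow flip: sum_distrib_left)
  \<comment> \<open>The coefficient 2 of \<open>(a v) ^ 4\<close> is raised to 6 to complete the
    square of \<open>?A + (a v)\<^sup>2\<close>.\<close>
  also have "\<dots> \<le> 2 * (3 * ?N * ?A\<^sup>2) + 12 * (a v)\<^sup>2 * (?N * ?A) + ?N * (6 * (a v) ^ 4)"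
    using insert.IH by (intro add_mono mult_left_mono) auto
  also have "\<dots> = 3 * 2 ^ card (insert v V) * (\<Sum>v\<in>insert v V. (a v)\<^sup>2)\<^sup>2"
    using insert by (simp add: power4_eq_xxxx power2_eq_square algebra_simps)
  finally show ?case .
qed

text \<open>This will be averaged over an \<open>s\<close> with mean 1 and second moment at most 3.
  The bound \<open>1 - s + s\<^sup>2 / 2\<close> would then give only 3/2. Replacing
  \<open>s\<close> by \<open>c * s\<close> gives \<open>1 - c + 3 * c\<^sup>2 / 2\<close>, which is
  least at \<open>c = 1 / 3\<close>, with value 5/6.\<close>

lemma exp_minus_le_quadratic:
  fixes s :: real
  assumes "0 \<le> s"
  shows "exp (- s) \<le> 1 - s / 3 + s\<^sup>2 / 18"
proof -
  define t where "t = s / 3"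
  have t: "0 \<le> t" "s = 3 * t" using assms by (auto simp: t_def)
  have pos: "0 \<le> 1 - t + t\<^sup>2 / 2"
    using zero_le_power2[of "t - 1"] by (simp add: power2_eq_square algebra_simps)
  \<comment> \<open>The product equals \<open>1 + t ^ 4 / 4\<close>.\<close>
  have "1 \<le> (1 + t + t\<^sup>2 / 2) * (1 - t + t\<^sup>2 / 2)"
    using t(1) by (simp add: power2_eq_square algebra_simps)
  also have "\<dots> \<le> exp t * (1 - t + t\<^sup>2 / 2)"
    using exp_lower_Taylor_quadratic[OF t(1)] pos by (rule mult_right_mono)
  finally have "exp (- t) \<le> 1 - t + t\<^sup>2 / 2"
    by (simp add: exp_minus field_simps)
  moreover have "exp (- s) \<le> exp (- t)" using t by simp
  ultimately have "exp (- s) \<le> 1 - t + t\<^sup>2 / 2" by linarith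
  then show ?thesis
    by (simp add: t_def power2_eq_square)
qed

text \<open>With \<open>s = (L S)\<^sup>2 / A\<close>, each term is
  \<open>A ^ N * (1 - s / k) ^ N\<close>, and \<open>N \<ge> k\<close> bounds the second factor by
  \<open>exp (- s)\<close>. The moments of \<open>s\<close> then give
  \<open>1 - 1 / 3 + 3 / 18 = 5 / 6\<close>.\<close>

lemma random_sign_contraction:
  fixes a :: "'a \<Rightarrow> real"
  assumes V: "finite V" "V \<noteq> {}" "card V \<le> N"
  shows "(\<Sum>S\<in>Pow V. ((\<Sum>v\<in>V. (a v)\<^sup>2) - (signed_sum a V S)\<^sup>2 / card V) ^ N)
    \<le> 5 / 6 * 2 ^ card V * (\<Sum>v\<in>V. (a v)\<^sup>2) ^ N"
proof -
  define A where "A = (\<Sum>v\<in>V. (a v)\<^sup>2)"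
  define k where "k = real (card V)"
  define L where "L = signed_sum a V"
  have k: "0 < k" "k \<le> N" using V by (auto simp: k_def card_gt_0_iff)
  then have N: "0 < N" by (cases N) auto
  have A: "0 \<le> A" by (simp add: A_def sum_nonneg)
  \<comment> \<open>Cauchy-Schwarz keeps the base \<open>1 - s / k\<close> nonnegative, as the
    monotonicity of powers requires.\<close>
  have L_le: "(L S)\<^sup>2 \<le> k * A" for S
  proof -
    have "(L S)\<^sup>2 \<le> (\<Sum>v\<in>V. ((if v \<in> S then 1 else -1)::real)\<^sup>2) * A"
      unfolding L_def signed_sum_def A_def by (rule Cauchy_Schwarz_ineq_sum)
    also have "(\<Sum>v\<in>V. ((if v \<in> S then 1 else -1)::real)\<^sup>2) = (\<Sum>v\<in>V. 1)"
      by (intro sum.cong) auto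
    finally show ?thesis by (simp add: k_def)
  qed
  have "(\<Sum>S\<in>Pow V. (A - (L S)\<^sup>2 / k) ^ N) \<le> 5 / 6 * 2 ^ card V * A ^ N"
  proof (cases "A = 0")
    case True
    then show ?thesis using L_le N by (simp add: power_0_left)
  next
    case False
    with A have A: "0 < A" by simp
    have "(A - (L S)\<^sup>2 / k) ^ N \<le> A ^ N * (1 - (L S)\<^sup>2 / (3 * A) + (L S) ^ 4 / (18 * A\<^sup>2))" for S
    proof -
      define s where "s = (L S)\<^sup>2 / A"
      have s: "0 \<le> s" "(L S)\<^sup>2 = s * A" using A by (auto simp: s_def)
      have "0 \<le> 1 - s / k"
        using L_le[of S] A k by (simp add: s field_simps)
      moreover have "1 - s / k \<le> exp (- (s / k))"
        using exp_ge_add_one_self[of "- (s / k)"] by simp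
      ultimately have "(1 - s / k) ^ N \<le> exp (- (s / k)) ^ N"
        by (intro power_mono)
      also have "\<dots> = exp (- (s * (N / k)))"
        by (simp add: exp_of_nat_mult[symmetric] mult_ac)
      also have "\<dots> \<le> exp (- (s * 1))"
        using s k by (simp only: exp_le_cancel_iff neg_le_iff_le) (intro mult_left_mono, auto)
      also have "\<dots> \<le> 1 - s / 3 + s\<^sup>2 / 18"
        using exp_minus_le_quadratic[OF s(1)] by simp
      finally have *: "A ^ N * (1 - s / k) ^ N \<le> A ^ N * (1 - s / 3 + s\<^sup>2 / 18)"
        using A by (intro mult_left_mono) auto
      have "A - (L S)\<^sup>2 / k = A * (1 - s / k)"
        by (simp add: s algebra_simps)
      then have "(A - (L S)\<^sup>2 / k) ^ N = A ^ N * (1 - s / k) ^ N"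
        by (simp add: power_mult_distrib)
      moreover have "(L S) ^ 4 = s\<^sup>2 * A\<^sup>2"
        using arg_cong[OF s(2), of "\<lambda>x. x\<^sup>2"] by (simp add: power_mult_distrib flip: power_mult)
      ultimately show ?thesis
        using * A by (simp add: s_def)
    qed
    then have "(\<Sum>S\<in>Pow V. (A - (L S)\<^sup>2 / k) ^ N)
        \<le> (\<Sum>S\<in>Pow V. A ^ N * (1 - (L S)\<^sup>2 / (3 * A) + (L S) ^ 4 / (18 * A\<^sup>2)))"
      by (intro sum_mono)
    also have "\<dots> = A ^ N * (2 ^ card V - (\<Sum>S\<in>Pow V. (L S)\<^sup>2) / (3 * A) + (\<Sum>S\<in>Pow V. (L S) ^ 4) / (18 * A\<^sup>2))"
      using V by (simp add: sum.distrib sum_subtractf card_Pow flip: sum_distrib_left sum_divide_distrib)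
    also have "\<dots> \<le> A ^ N * (2 ^ card V - (2 ^ card V * A) / (3 * A) + (3 * 2 ^ card V * A\<^sup>2) / (18 * A\<^sup>2))"
      using signed_sum_second_moment[OF V(1), of a] signed_sum_fourth_moment[OF V(1), of a] A
      by (intro mult_left_mono add_mono divide_right_mono) (auto simp: L_def A_def)
    also have "\<dots> = 5 / 6 * 2 ^ card V * A ^ N"
      using A by (simp add: field_simps)
    finally show ?thesis .
  qed
  then show ?thesis by (simp add: A_def k_def L_def)
qed

section \<open>Choosing the kernel directions by averaging over signs\<close>

context euclidean_Rn
begin

text \<open>Coefficients \<open>1 / sqrt k\<close> and \<open>- 1 / sqrt k\<close> make every
  \<open>w S\<close> a unit vector orthogonal to \<open>U\<close>. Adding it to \<open>U\<close>
  lowers each squared residual length by the square of a signed sum divided by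
  \<open>k\<close>.\<close>

lemma orthonormal_step:
  assumes U: "orthonormal U" "card U < n" and X: "finite X" "X \<subseteq> Rn n"
  obtains v where "v \<notin> U" "orthonormal (insert v U)"
    "(\<Sum>x\<in>X. ip (residual (insert v U) x) (residual (insert v U) x) ^ n)
      \<le> 5 / 6 * (\<Sum>x\<in>X. ip (residual U x) (residual U x) ^ n)"
proof -
  obtain V where V: "U \<inter> V = {}" "orthonormal (U \<union> V)" "card (U \<union> V) = n"
    using orthonormal_completion[OF U(1)] .
  have fin: "finite U" "finite V" using orthonormalD(1)[OF V(2)] by auto
  have card: "card U + card V = n"
    using card_Un_disjoint[OF fin V(1)] V(3) by simp
  have ne: "V \<noteq> {}" using card U(2) by auto
  have V': "orthonormal V" by (rule orthonormal_subset[OF V(2)]) auto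
  have V_mem: "v \<in> Rn n" if "v \<in> V" for v using orthonormalD(2)[OF V' that] .
  define k where "k = real (card V)"
  have k: "0 < k" using ne fin by (simp add: k_def card_gt_0_iff)
  define sg where "sg S v = (if v \<in> S then 1 else -1 :: real)" for S and v :: "nat \<Rightarrow>\<^sub>0 real"
  define w where "w S = (\<Sum>v\<in>V. (sg S v / sqrt k) *\<^sub>R v)" for S
  define \<Phi> where "\<Phi> W = (\<Sum>x\<in>X. ip (residual W x) (residual W x) ^ n)" for W
  have w_mem: "w S \<in> Rn n" for S
    unfolding w_def by (intro Rn_sum_closed Rn_closed V_mem)
  have w_unit: "ip (w S) (w S) = 1" for S
  proof -
    have "ip (w S) (w S) = (\<Sum>v\<in>V. (sg S v / sqrt k)\<^sup>2)"
      unfolding w_def by (rule ip_self_orthonormal_lincomb[OF V'])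
    also have "\<dots> = (\<Sum>v\<in>V. 1 / k)"
      using k by (intro sum.cong) (auto simp: sg_def power_divide)
    finally show ?thesis using k by (simp add: k_def)
  qed
  have w_orth: "ip (w S) u = 0" if "u \<in> U" for S u
  proof -
    have "ip (w S) u = (\<Sum>v\<in>V. (sg S v / sqrt k) * ip v u)"
      unfolding w_def using fin V_mem orthonormalD(2)[OF U(1) that] by (intro ip_lincomb_left)
    also have "\<dots> = 0"
      using orthonormalD(3)[OF V(2)] V(1) that by (intro sum.neutral) auto
    finally show ?thesis .
  qed
  have ortho: "w S \<notin> U" "orthonormal (insert (w S) U)" for S
    using orthonormal_insert[OF U(1) w_mem w_unit w_orth] by auto
  have step: "ip (residual (insert (w S) U) x) (residual (insert (w S) U) x) =
      (\<Sum>v\<in>V. (ip x v)\<^sup>2) - (signed_sum (ip x) V S)\<^sup>2 / card V" if x: "x \<in> Rn n" for S x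
  proof -
    have "ip x (w S) = (\<Sum>v\<in>V. (sg S v / sqrt k) * ip x v)"
      unfolding w_def using fin V_mem x by (intro ip_lincomb_right)
    also have "\<dots> = signed_sum (ip x) V S / sqrt k"
      by (simp add: signed_sum_def sg_def sum_divide_distrib)
    finally have "(ip x (w S))\<^sup>2 = (signed_sum (ip x) V S)\<^sup>2 / k"
      using k by (simp add: power_divide)
    then show ?thesis
      using ip_residual_self[OF ortho(2) x] ip_residual_self[OF U(1) x]
        residual_eq_lincomb(2)[OF V(2,3,1) x] ortho(1) fin by (simp add: k_def)
  qed
  have "(\<Sum>S\<in>Pow V. \<Phi> (insert (w S) U)) =
      (\<Sum>x\<in>X. \<Sum>S\<in>Pow V. ip (residual (insert (w S) U) x) (residual (insert (w S) U) x) ^ n)"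
    unfolding \<Phi>_def by (rule sum.swap)
  also have "\<dots> = (\<Sum>x\<in>X. \<Sum>S\<in>Pow V. ((\<Sum>v\<in>V. (ip x v)\<^sup>2) - (signed_sum (ip x) V S)\<^sup>2 / card V) ^ n)"
    using X(2) by (intro sum.cong refl) (simp add: step subset_iff)
  also have "\<dots> \<le> (\<Sum>x\<in>X. 5 / 6 * 2 ^ card V * (\<Sum>v\<in>V. (ip x v)\<^sup>2) ^ n)"
    using fin ne card by (intro sum_mono random_sign_contraction) auto
  also have "\<dots> = (\<Sum>x\<in>X. 5 / 6 * 2 ^ card V * ip (residual U x) (residual U x) ^ n)"
    using X(2) by (intro sum.cong refl) (simp add: residual_eq_lincomb(2)[OF V(2,3,1)] subset_iff)
  also have "\<dots> = (\<Sum>S\<in>Pow V. 5 / 6 * \<Phi> U)"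
    using fin by (simp add: \<Phi>_def card_Pow sum_distrib_left sum_divide_distrib mult_ac)
  \<comment> \<open>If every sign pattern exceeded the bound, so would the sum over all
    patterns.\<close>
  finally have "\<exists>S\<in>Pow V. \<Phi> (insert (w S) U) \<le> 5 / 6 * \<Phi> U"
    using sum_strict_mono[of "Pow V" "\<lambda>_. 5 / 6 * \<Phi> U" "\<lambda>S. \<Phi> (insert (w S) U)"] fin
    by (force simp: not_le[symmetric])
  then show ?thesis
    using that ortho unfolding \<Phi>_def by blast
qed

lemma orthonormal_contraction:
  assumes "m \<le> n" and X: "finite X" "X \<subseteq> Rn n"
  obtains U where "orthonormal U" "card U = m"
    "(\<Sum>x\<in>X. ip (residual U x) (residual U x) ^ n) \<le> (5 / 6) ^ m * (\<Sum>x\<in>X. ip x x ^ n)"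
proof -
  have "\<exists>U. orthonormal U \<and> card U = m \<and>
    (\<Sum>x\<in>X. ip (residual U x) (residual U x) ^ n) \<le> (5 / 6) ^ m * (\<Sum>x\<in>X. ip x x ^ n)"
    using \<open>m \<le> n\<close>
  proof (induction m)
    case 0
    have "orthonormal {}" by (simp add: orthonormal_def)
    then show ?case by (intro exI[of _ "{}"]) (simp add: residual_def)
  next
    case (Suc m)
    then obtain U where U: "orthonormal U" "card U = m"
      "(\<Sum>x\<in>X. ip (residual U x) (residual U x) ^ n) \<le> (5 / 6) ^ m * (\<Sum>x\<in>X. ip x x ^ n)"
      by auto
    from U(2) Suc have "card U < n" by simp
    from orthonormal_step[OF U(1) this X] obtain v where v: "v \<notin> U" "orthonormal (insert v U)"
      "(\<Sum>x\<in>X. ip (residual (insert v U) x) (residual (insert v U) x) ^ n)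
        \<le> 5 / 6 * (\<Sum>x\<in>X. ip (residual U x) (residual U x) ^ n)" .
    have "card (insert v U) = Suc m"
      using v(1) U(2) orthonormalD(1)[OF U(1)] by simp
    moreover have "5 / 6 * (\<Sum>x\<in>X. ip (residual U x) (residual U x) ^ n)
        \<le> (5 / 6) ^ Suc m * (\<Sum>x\<in>X. ip x x ^ n)"
      using U(3) by simp
    ultimately show ?case
      using v(2,3) by (intro exI[of _ "insert v U"]) linarith
  qed
  then show ?thesis using that by blast
qed

end

subsection \<open>A volumetric packing bound\<close>

context euclidean_Rn
begin

lemma measurable_scale_Rn: "(\<lambda>x. c *\<^sub>R x) \<in> borel_Rn n \<rightarrow>\<^sub>M borel_Rn n"
  by (rule measurable_into_Rn)
     (auto simp: lookup_scaleR intro!: borel_measurable_times measurable_lookup)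

lemma measurable_ip:
  assumes "x \<in> Rn n"
  shows "ip x \<in> borel_measurable (borel_Rn n)"
proof -
  have "(\<lambda>y. \<Sum>i<n. \<Sum>j<n. Poly_Mapping.lookup x i * Poly_Mapping.lookup y j * ip (std_vec i) (std_vec j))
      \<in> borel_measurable (borel_Rn n)"
    using measurable_lookup by measurable
  then show ?thesis
    by (rule measurable_cong[THEN iffD1, rotated]) (simp add: ip_expand[OF ip assms, symmetric])
qed

text \<open>The image of Lebesgue measure under scaling by \<open>inverse c\<close> is translation
  invariant, hence proportional to Lebesgue measure. The cube \<open>?Q\<close>, whose measure is
  explicit in coordinates, identifies the factor as \<open>c ^ n\<close>.\<close>

lemma emeasure_enorm_ball:
  assumes c: "0 < c"
  shows "emeasure (lebesgue_Rn n) {x \<in> Rn n. enorm ip x \<le> c} =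
    ennreal (c ^ n) * emeasure (lebesgue_Rn n) (unit_ball n ip)"
proof -
  let ?L = "lebesgue_Rn n" and ?M = "borel_Rn n" and ?D = "unit_ball n ip"
  let ?h = "\<lambda>x. inverse c *\<^sub>R x" and ?Q = "{x \<in> Rn n. \<forall>i<n. \<bar>Poly_Mapping.lookup x i\<bar> \<le> 1}"
  let ?\<nu> = "distr ?L ?M ?h"
  have h: "?h \<in> ?L \<rightarrow>\<^sub>M ?M"
    using measurable_scale_Rn by (simp cong: measurable_cong_sets add: sets_lebesgue_Rn)
  have sf: "sigma_finite_measure ?\<nu>"
  proof (rule sigma_finite_measure_distr)
    show g: "(\<lambda>x. c *\<^sub>R x) \<in> ?\<nu> \<rightarrow>\<^sub>M ?M"
      using measurable_scale_Rn by (simp cong: measurable_cong_sets)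
    have "distr ?\<nu> ?M (\<lambda>x. c *\<^sub>R x) = distr ?L ?M (\<lambda>x. x)"
      using c by (subst distr_distr[OF measurable_scale_Rn h], intro distr_cong refl) simp
    also have "\<dots> = ?L"
      by (rule distr_id2) (simp add: sets_lebesgue_Rn)
    finally show "sigma_finite_measure (distr ?\<nu> ?M (\<lambda>x. c *\<^sub>R x))"
      by (simp add: sigma_finite_lebesgue_Rn)
  qed
  have inv: "distr ?\<nu> ?M (\<lambda>x. x + b) = ?\<nu>" if b: "b \<in> Rn n" for b
  proof -
    have m: "(\<lambda>x. x + b) \<in> ?M \<rightarrow>\<^sub>M ?M"
      using b by (auto intro!: measurable_Rn_add)
    have m': "(\<lambda>x. x + c *\<^sub>R b) \<in> ?L \<rightarrow>\<^sub>M ?M"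
      using b by (auto intro!: measurable_Rn_add simp: sets_lebesgue_Rn cong: measurable_cong_sets)
    have "distr ?\<nu> ?M (\<lambda>x. x + b) = distr ?L ?M (\<lambda>x. ?h (x + c *\<^sub>R b))"
      using c by (subst distr_distr[OF m h], intro distr_cong refl) (simp add: scaleR_add_right)
    also have "\<dots> = distr (distr ?L ?M (\<lambda>x. x + c *\<^sub>R b)) ?M ?h"
      by (subst distr_distr[OF measurable_scale_Rn m']) (simp add: o_def)
    also have "\<dots> = ?\<nu>"
      using b by (simp add: translation_lebesgue_Rn)
    finally show ?thesis .
  qed
  have D: "?D \<in> sets ?M" by (rule sets_unit_ball[OF ip])
  have Q: "?Q \<in> sets ?M" using emeasure_cube(1)[of 1 n] by (simp only: sets_lebesgue_Rn zero_le_one)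
  have "?h -` ?D \<inter> Rn n = {x \<in> Rn n. enorm ip x \<le> c}"
    using c by (auto simp: unit_ball_def enorm_scale divide_le_eq_1 divide_inverse[symmetric] mult.commute[of "inverse c"])
  then have nuD: "emeasure ?\<nu> ?D = emeasure ?L {x \<in> Rn n. enorm ip x \<le> c}"
    using emeasure_distr[OF h D] by simp
  have "?h -` ?Q \<inter> Rn n = {x \<in> Rn n. \<forall>i<n. \<bar>Poly_Mapping.lookup x i\<bar> \<le> c}"
    using c by (auto simp: lookup_scaleR abs_mult divide_le_eq_1 divide_inverse[symmetric] mult.commute[of "inverse c"])
  then have nuQ: "emeasure ?\<nu> ?Q = ennreal (c ^ n) * ennreal (2 ^ n)"
    using emeasure_distr[OF h Q] emeasure_cube(2)[of c n] c
    by (simp add: ennreal_power power_mult_distrib mult.commute flip: ennreal_mult)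
  have LQ: "emeasure ?L ?Q = ennreal (2 ^ n)"
    using emeasure_cube(2)[of 1 n] ennreal_power[of 2 n] by simp
  have "ennreal (2 ^ n) * emeasure ?\<nu> ?D = ennreal (2 ^ n) * (ennreal (c ^ n) * emeasure ?L ?D)"
    using translation_invariant_proportional[OF _ sf inv D Q] nuQ LQ by (simp add: mult_ac)
  then show ?thesis
    using nuD by (simp add: ennreal_mult_cancel_left)
qed

lemma measure_translate:
  assumes A: "A \<in> sets (borel_Rn n)" and b: "b \<in> Rn n"
  shows "(\<lambda>y. b + y) ` A \<in> sets (borel_Rn n)"
    and "measure (lebesgue_Rn n) ((\<lambda>y. b + y) ` A) = measure (lebesgue_Rn n) A"
proof -
  have sub: "A \<subseteq> Rn n" using sets.sets_into_space[OF A] by simp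
  have m: "(\<lambda>x. x + - b) \<in> borel_Rn n \<rightarrow>\<^sub>M borel_Rn n"
    using b by (intro measurable_Rn_add) auto
  have eq: "(\<lambda>y. b + y) ` A = (\<lambda>x. x + - b) -` A \<inter> Rn n"
    using sub b by (auto simp: image_iff intro!: bexI[of _ "_ - b"])
  show "(\<lambda>y. b + y) ` A \<in> sets (borel_Rn n)"
    unfolding eq using measurable_sets[OF m A] by simp
  have "measure (lebesgue_Rn n) A = measure (distr (lebesgue_Rn n) (borel_Rn n) (\<lambda>x. x + - b)) A"
    using b by (subst translation_lebesgue_Rn) auto
  also have "\<dots> = measure (lebesgue_Rn n) ((\<lambda>y. b + y) ` A)"
    unfolding eq using m A
    by (subst measure_distr) (auto simp: sets_lebesgue_Rn cong: measurable_cong_sets)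
  finally show "measure (lebesgue_Rn n) ((\<lambda>y. b + y) ` A) = measure (lebesgue_Rn n) A" ..
qed

lemma measure_uminus:
  assumes A: "A \<in> sets (borel_Rn n)"
  shows "uminus ` A \<in> sets (borel_Rn n)"
    and "measure (lebesgue_Rn n) (uminus ` A) = measure (lebesgue_Rn n) A"
proof -
  have sub: "A \<subseteq> Rn n" using sets.sets_into_space[OF A] by simp
  have m: "uminus \<in> borel_Rn n \<rightarrow>\<^sub>M borel_Rn n"
    using measurable_scale_Rn[of "-1"] by simp
  have eq: "uminus ` A = uminus -` A \<inter> Rn n"
    using sub by (auto simp: image_iff intro!: bexI[of _ "- _"])
  show "uminus ` A \<in> sets (borel_Rn n)"
    unfolding eq using measurable_sets[OF m A] by simp
  have "measure (lebesgue_Rn n) A = measure (distr (lebesgue_Rn n) (borel_Rn n) uminus) A"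
    using reflection_lebesgue_Rn[of 0 n] by simp
  also have "\<dots> = measure (lebesgue_Rn n) (uminus ` A)"
    unfolding eq using m A
    by (subst measure_distr) (auto simp: sets_lebesgue_Rn cong: measurable_cong_sets)
  finally show "measure (lebesgue_Rn n) (uminus ` A) = measure (lebesgue_Rn n) A" ..
qed

text \<open>The translates by \<open>a x\<close> of the part of \<open>H\<close> that makes an obtuse angle with \<open>x\<close> are disjoint and
  stay in a ball whose squared radius is only \<open>1 + a\<^sup>2\<close>.\<close>

lemma packing_bound:
  assumes n: "0 < n" and H: "H \<in> sets (borel_Rn n)" "H \<subseteq> unit_ball n ip" "\<And>y. y \<in> H \<Longrightarrow> - y \<in> H"
    and half: "measure (lebesgue_Rn n) (unit_ball n ip) \<le> 2 * measure (lebesgue_Rn n) H"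
    and X: "finite X" "X \<subseteq> unit_ball n ip"
    and a: "0 \<le> a" and sep: "\<And>x x' y y'. x \<in> X \<Longrightarrow> x' \<in> X \<Longrightarrow> y \<in> H \<Longrightarrow> y' \<in> H \<Longrightarrow> x \<noteq> x' \<Longrightarrow>
      a *\<^sub>R x + y \<noteq> a *\<^sub>R x' + y'"
  shows "real (card X) \<le> 4 * exp (a\<^sup>2 * n / 2)"
proof -
  let ?L = "lebesgue_Rn n" and ?D = "unit_ball n ip"
  define c where "c = sqrt (1 + a\<^sup>2)"
  define B where "B = {x \<in> Rn n. enorm ip x \<le> c}"
  define d where "d = measure ?L ?D"
  have c: "0 < c" "c\<^sup>2 = 1 + a\<^sup>2" by (auto simp: c_def add_pos_nonneg)
  have d: "0 < d" "emeasure ?L ?D = ennreal d"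
    using emeasure_unit_ball[OF ip n] by (auto simp: d_def measure_def enn2real_positive_iff less_top zero_less_iff_neq_zero)
  have emB: "emeasure ?L B = ennreal (c ^ n * d)"
    using c d by (simp add: B_def emeasure_enorm_ball ennreal_mult)
  then have mB: "measure ?L B = c ^ n * d"
    using c d by (simp add: measure_def)
  have B_sets: "B \<in> sets (borel_Rn n)"
  proof -
    have "{x \<in> space (borel_Rn n). enorm ip x \<le> c} \<in> sets (borel_Rn n)"
      using measurable_enorm[OF ip] by measurable
    then show ?thesis by (simp add: B_def)
  qed
  have fm: "A \<in> fmeasurable ?L" if "A \<in> sets (borel_Rn n)" "A \<subseteq> B" for A
  proof (rule fmeasurableI2[of B])
    show "B \<in> fmeasurable ?L"
      using B_sets emB by (auto simp: fmeasurable_def sets_lebesgue_Rn)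
  qed (use that in \<open>auto simp: sets_lebesgue_Rn\<close>)
  have "1 \<le> c" by (simp add: c_def)
  then have DB: "?D \<subseteq> B" by (auto simp: B_def unit_ball_def)
  define Hx where "Hx x = {y \<in> H. ip x y \<le> 0}" for x
  have Hx_sets: "Hx x \<in> sets (borel_Rn n)" if "x \<in> Rn n" for x
  proof -
    have "{y \<in> space (borel_Rn n). ip x y \<le> 0} \<in> sets (borel_Rn n)"
      using measurable_ip[OF that] by measurable
    then have "H \<inter> {y \<in> space (borel_Rn n). ip x y \<le> 0} \<in> sets (borel_Rn n)"
      using H(1) by blast
    moreover have "H \<inter> {y \<in> space (borel_Rn n). ip x y \<le> 0} = Hx x"
      using H(2) by (auto simp: Hx_def unit_ball_def)
    ultimately show ?thesis by simp
  qed
  have Hx_measure: "d / 4 \<le> measure ?L (Hx x)" if x: "x \<in> Rn n" for x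
  proof -
    \<comment> \<open>By symmetry, \<open>Hx x\<close> and its reflection cover \<open>H\<close>, so
      \<open>Hx x\<close> has at least half the volume of \<open>H\<close> and hence a quarter of
      that of the ball. This is the source of the constant 4.\<close>
    have "H \<subseteq> Hx x \<union> uminus ` Hx x"
    proof
      fix y assume y: "y \<in> H"
      then have yR: "y \<in> Rn n" using H(2) by (auto simp: unit_ball_def)
      show "y \<in> Hx x \<union> uminus ` Hx x"
      proof (cases "ip x y \<le> 0")
        case False
        then have "- y \<in> Hx x"
          using H(3)[OF y] ip_scale_right[of y x "-1"] x yR by (simp add: Hx_def)
        then show ?thesis by (auto simp: image_iff intro!: bexI[of _ "- y"])
      qed (use y in \<open>simp add: Hx_def\<close>)
    qed
    moreover have "Hx x \<in> fmeasurable ?L" "uminus ` Hx x \<in> fmeasurable ?L"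
      using Hx_sets[OF x] measure_uminus(1)[OF Hx_sets[OF x]] H(2,3) DB by (auto intro!: fm simp: Hx_def)
    ultimately have "measure ?L H \<le> measure ?L (Hx x \<union> uminus ` Hx x)"
      using H(1) by (intro measure_mono_fmeasurable) (auto simp: sets_lebesgue_Rn)
    also have "\<dots> \<le> measure ?L (Hx x) + measure ?L (uminus ` Hx x)"
      using Hx_sets[OF x] measure_uminus(1)[OF Hx_sets[OF x]] H(2,3) DB
      by (intro measure_Un_le) (auto simp: sets_lebesgue_Rn)
    finally show ?thesis
      using half measure_uminus(2)[OF Hx_sets[OF x]] by (simp add: d_def)
  qed
  define S where "S x = (\<lambda>y. a *\<^sub>R x + y) ` Hx x" for x
  have XR: "x \<in> Rn n" "ip x x \<le> 1" if "x \<in> X" for x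
    using that X(2) by (auto simp: mem_unit_ball)
  have S_sets: "S x \<in> sets (borel_Rn n)" "measure ?L (S x) = measure ?L (Hx x)" if "x \<in> X" for x
    unfolding S_def using measure_translate[OF Hx_sets] XR(1)[OF that] by auto
  have S_sub: "S x \<subseteq> B" if x: "x \<in> X" for x
  proof
    fix z assume "z \<in> S x"
    then obtain y where y: "y \<in> H" "ip x y \<le> 0" "z = a *\<^sub>R x + y" by (auto simp: S_def Hx_def)
    have yR: "y \<in> Rn n" "ip y y \<le> 1" using y(1) H(2) by (auto simp: mem_unit_ball)
    have aR: "a *\<^sub>R x \<in> Rn n" using XR(1)[OF x] by auto
    have sq: "ip z z \<le> c\<^sup>2"
    proof -
      have "ip z z = a\<^sup>2 * ip x x + 2 * a * ip x y + ip y y"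
        using XR(1)[OF x] yR(1) aR ip_commute[of y x]
        by (simp add: y(3) ip_add_left ip_add_right ip_scale_left ip_scale_right power2_eq_square algebra_simps)
      also have "\<dots> \<le> a\<^sup>2 * 1 + 0 + 1"
        using XR(2)[OF x] yR(2) y(2) a by (intro add_mono mult_left_mono) (auto simp: mult_nonneg_nonpos)
      finally show ?thesis by (simp add: c(2))
    qed
    have zR: "z \<in> Rn n" using aR yR(1) y(3) by auto
    then show "z \<in> B"
      using sq c(1) by (auto simp: B_def enorm_def intro!: real_le_lsqrt ip_self_nonneg)
  qed
  have disj: "disjoint_family_on S X"
    unfolding disjoint_family_on_def S_def Hx_def using sep by fastforce
  have "card X * (d / 4) = (\<Sum>x\<in>X. d / 4)" by simp
  also have "\<dots> \<le> (\<Sum>x\<in>X. measure ?L (S x))"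
    using Hx_measure XR S_sets(2) by (intro sum_mono) auto
  also have "\<dots> = measure ?L (\<Union>x\<in>X. S x)"
    using X(1) fm[OF S_sets(1) S_sub] disj
    by (intro measure_finite_Union[symmetric]) (force simp: fmeasurable_def)+
  also have "\<dots> \<le> measure ?L B"
    using X(1) S_sets(1) S_sub fm[OF B_sets]
    by (intro measure_mono_fmeasurable) (auto simp: sets_lebesgue_Rn intro!: sets.finite_UN)
  finally have "card X * (d / 4) \<le> c ^ n * d" by (simp add: mB)
  then have "card X \<le> 4 * c ^ n" using d(1) by simp
  also have "c ^ n \<le> exp (a\<^sup>2 / 2) ^ n"
  proof (rule power_mono)
    have "c\<^sup>2 \<le> (exp (a\<^sup>2 / 2))\<^sup>2"
      using exp_ge_add_one_self[of "a\<^sup>2"] c(2) by (simp add: exp_double[symmetric])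
    then show "c \<le> exp (a\<^sup>2 / 2)" by (rule power2_le_imp_le) simp
  qed (use c in simp)
  also have "\<dots> = exp (a\<^sup>2 * n / 2)"
    by (simp add: exp_of_nat_mult[symmetric] mult_ac)
  finally show ?thesis by simp
qed

end

subsection \<open>Star bodies and their gauges\<close>

lemma mem_scale_image:
  fixes x :: "'a::real_vector"
  shows "s \<noteq> 0 \<Longrightarrow> x \<in> (*\<^sub>R) s ` K \<longleftrightarrow> x /\<^sub>R s \<in> K"
  by (auto simp: image_iff intro!: bexI[of _ "x /\<^sub>R s"])

text \<open>The homogeneous form of \<open>p\<close>-convexity: dividing both coefficients by
  \<open>g\<close> makes their \<open>p\<close>-th powers sum to 1.\<close>

lemma p_convex_lincomb:
  fixes Q :: "'a::real_vector set"
  assumes p: "0 < p" and Q: "p_convex p Q" and ab: "0 < a" "0 < b" and xy: "x \<in> Q" "y \<in> Q"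
  shows "a *\<^sub>R x + b *\<^sub>R y \<in> (*\<^sub>R) ((a powr p + b powr p) powr (1 / p)) ` Q"
proof -
  define g where "g = (a powr p + b powr p) powr (1 / p)"
  have sum: "0 < a powr p + b powr p" using ab by (simp add: add_pos_pos)
  have g: "0 < g" "g powr p = a powr p + b powr p"
    using sum p by (auto simp: g_def powr_powr)
  have "(a / g) powr p + (b / g) powr p = (a powr p + b powr p) / g powr p"
    using ab g(1) by (simp add: powr_divide add_divide_distrib)
  then have "(a / g) powr p + (b / g) powr p = 1"
    using g sum by simp
  then have "(a / g) *\<^sub>R x + (b / g) *\<^sub>R y \<in> Q"
    using Q xy ab g(1) unfolding p_convex_def by simp
  then show ?thesis
    unfolding g_def[symmetric] using g(1)
    by (simp add: mem_scale_image scaleR_add_right divide_inverse mult.commute)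
qed

lemma p_convex_image:
  assumes "linear f" "p_convex p K"
  shows "p_convex p (f ` K)"
  unfolding p_convex_def
proof (intro allI impI ballI)
  fix \<alpha> \<beta> x y assume *: "0 < \<alpha> \<and> 0 < \<beta> \<and> \<alpha> powr p + \<beta> powr p = 1" "x \<in> f ` K" "y \<in> f ` K"
  then obtain u v where uv: "u \<in> K" "v \<in> K" "x = f u" "y = f v" by auto
  then have "\<alpha> *\<^sub>R u + \<beta> *\<^sub>R v \<in> K" using assms(2) * unfolding p_convex_def by blast
  moreover have "f (\<alpha> *\<^sub>R u + \<beta> *\<^sub>R v) = \<alpha> *\<^sub>R x + \<beta> *\<^sub>R y"
    using assms(1) uv by (simp add: linear_add linear_scale)
  ultimately show "\<alpha> *\<^sub>R x + \<beta> *\<^sub>R y \<in> f ` K" by (metis imageI)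
qed

lemma star_scale_mono:
  fixes Q :: "'a::real_vector set"
  assumes star: "\<And>c x. 0 \<le> c \<Longrightarrow> c \<le> 1 \<Longrightarrow> x \<in> Q \<Longrightarrow> c *\<^sub>R x \<in> Q" and "0 < R" "R \<le> S"
  shows "(*\<^sub>R) R ` Q \<subseteq> (*\<^sub>R) S ` Q"
proof (intro subsetI, elim imageE)
  fix x q assume x: "x = R *\<^sub>R q" "q \<in> Q"
  have "(R / S) *\<^sub>R q \<in> Q" using assms x by (intro star) auto
  moreover have "x = S *\<^sub>R ((R / S) *\<^sub>R q)" using assms x by simp
  ultimately show "x \<in> (*\<^sub>R) S ` Q" by blast
qed

text \<open>Iterating the covering multiplies the \<open>p\<close>-th power of an inclusion constant by
  \<open>r powr p\<close> and adds \<open>t powr p\<close>, so the constants approach the fixed point of this affine map.\<close>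

lemma p_convex_absorb:
  fixes E Q :: "'a::real_vector set"
  assumes p: "0 < p" and Q: "p_convex p Q"
    and star: "\<And>c x. 0 \<le> c \<Longrightarrow> c \<le> 1 \<Longrightarrow> x \<in> Q \<Longrightarrow> c *\<^sub>R x \<in> Q"
    and R: "0 < R" "E \<subseteq> (*\<^sub>R) R ` Q"
    and cover: "\<And>x. x \<in> E \<Longrightarrow> \<exists>y\<in>E. \<exists>z\<in>Q. x = r *\<^sub>R y + t *\<^sub>R z"
    and r: "0 < r" "r < 1" and t: "0 < t"
    and B: "0 < B" "t powr p < (1 - r powr p) * B powr p"
  shows "E \<subseteq> (*\<^sub>R) B ` Q"
proof -
  define q where "q = r powr p"
  have q: "0 < q" "q < 1" using r p powr_less_mono2[of p r 1] by (auto simp: q_def)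
  define L where "L = t powr p / (1 - q)"
  have L: "0 < L" "L < B powr p" "t powr p + q * L = L"
    using q t B(2) by (auto simp: L_def q_def[symmetric] field_simps)
  \<comment> \<open>The affine recursion solved explicitly: \<open>c k\<close> is its fixed point
    \<open>L\<close> plus a geometrically decaying error. The initial inclusion constant
    \<open>R\<close> enters only the error.\<close>
  define c where "c k = L + q ^ k * R powr p" for k
  have c_pos: "0 < c k" for k using L(1) q R(1) by (simp add: c_def add_pos_nonneg)
  have E_c: "E \<subseteq> (*\<^sub>R) (c k powr (1 / p)) ` Q" for k
  proof (induction k)
    case 0
    have "R = (R powr p) powr (1 / p)" using R p by (simp add: powr_powr)
    also have "\<dots> \<le> c 0 powr (1 / p)"
      using L p by (intro powr_mono2) (auto simp: c_def)
    finally show ?case using star_scale_mono[OF star R(1)] R(2) by blast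
  next
    case (Suc k)
    show ?case
    proof
      fix x assume "x \<in> E"
      then obtain y z where yz: "y \<in> E" "z \<in> Q" "x = r *\<^sub>R y + t *\<^sub>R z" using cover by blast
      with Suc obtain w where w: "w \<in> Q" "y = c k powr (1 / p) *\<^sub>R w" by blast
      have "(r * c k powr (1 / p)) *\<^sub>R w + t *\<^sub>R z
          \<in> (*\<^sub>R) (((r * c k powr (1 / p)) powr p + t powr p) powr (1 / p)) ` Q"
        using r t c_pos[of k] w yz powr_gt_zero[of "c k" "1 / p"] by (intro p_convex_lincomb[OF p Q]) auto
      moreover have "(r * c k powr (1 / p)) powr p + t powr p = c (Suc k)"
        using r p c_pos[of k] L(3) by (simp add: powr_mult powr_powr q_def[symmetric] c_def algebra_simps)
      ultimately show "x \<in> (*\<^sub>R) (c (Suc k) powr (1 / p)) ` Q"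
        using yz w by simp
    qed
  qed
  \<comment> \<open>As \<open>L < B powr p\<close> strictly, finitely many iterations reach
    \<open>B\<close>, and no limit of sets has to be taken.\<close>
  have "(\<lambda>k. c k) \<longlonglongrightarrow> L + 0 * R powr p"
    unfolding c_def using q by (intro tendsto_intros LIMSEQ_power_zero) auto
  then have "\<forall>\<^sub>F k in sequentially. c k < B powr p"
    using L(2) by (intro order_tendstoD) auto
  then obtain k where "c k < B powr p" by (auto dest: eventually_happens)
  then have "c k powr (1 / p) \<le> (B powr p) powr (1 / p)"
    using p c_pos[of k] by (intro powr_mono2) auto
  also have "\<dots> = B" using p B(1) by (simp add: powr_powr)
  finally show ?thesis
    using star_scale_mono[OF star, where R = "c k powr (1 / p)" and S = B] E_c[of k] c_pos[of k] by auto
qed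

section \<open>The gauge of a body\<close>

context
  fixes n K
  assumes K: "body n K"
begin

lemma body_scale: "- 1 \<le> c \<Longrightarrow> c \<le> 1 \<Longrightarrow> x \<in> K \<Longrightarrow> c *\<^sub>R x \<in> K"
  using K unfolding body_def by (meson atLeastAtMost_iff image_subset_iff)

lemma body_uminus: "x \<in> K \<Longrightarrow> - x \<in> K"
  using body_scale[of "-1" x] by simp

lemma body_norm_ball:
  obtains e where "0 < e" "\<And>x. x \<in> Rn n \<Longrightarrow> norm x \<le> e \<Longrightarrow> x \<in> K"
proof -
  have "0 \<in> top_of_set (Rn n) interior_of K"
    using K by (simp add: body_def)
  then obtain T where T: "openin (top_of_set (Rn n)) T" "0 \<in> T" "T \<subseteq> K"
    by (auto simp: interior_of_def)
  then obtain e where e: "0 < e" "\<And>x. x \<in> Rn n \<Longrightarrow> dist x 0 < e \<Longrightarrow> x \<in> T"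
    unfolding openin_euclidean_subtopology_iff by blast
  show ?thesis
    by (rule that[of "e / 2"]) (use e T in auto)
qed

lemma body_zero: "0 \<in> K"
  using body_norm_ball subspace_0[OF subspace_Rn] by (metis less_imp_le norm_zero)

lemma body_bounded:
  obtains R where "0 < R" "\<And>x. x \<in> K \<Longrightarrow> norm x \<le> R"
  using K compact_imp_bounded[of K] unfolding body_def bounded_pos by blast

text \<open>The infimum is attained: \<open>x\<close> lies in the dilates by
  \<open>s + 1 / (k + 1)\<close>, and closedness of \<open>K\<close> passes to the limit. Sublevel
  sets of the gauge thus become dilates of \<open>K\<close>.\<close>

lemma gauge_le_iff:
  assumes s: "0 < s" and x: "x \<in> Rn n"
  shows "gauge_of K x \<le> s \<longleftrightarrow> x \<in> (*\<^sub>R) s ` K"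
proof
  let ?G = "{s. 0 < s \<and> x \<in> (*\<^sub>R) s ` K}"
  have bdd: "bdd_below ?G" by (rule bdd_belowI[of _ 0]) auto
  show "gauge_of K x \<le> s" if "x \<in> (*\<^sub>R) s ` K"
    unfolding gauge_of_def using that s bdd by (intro cInf_lower) auto
  assume le: "gauge_of K x \<le> s"
  obtain e where e: "0 < e" "\<And>x. x \<in> Rn n \<Longrightarrow> norm x \<le> e \<Longrightarrow> x \<in> K"
    using body_norm_ball by blast
  \<comment> \<open>Without this \<open>Inf ?G\<close> would be an unspecified value; it rests on
    the interior point 0.\<close>
  have ne: "?G \<noteq> {}"
  proof -
    define u where "u = (norm x + 1) / e"
    have u: "0 < u" using e by (simp add: u_def add_nonneg_pos)
    have "norm x \<le> e * u" using e by (simp add: u_def)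
    then have "norm (x /\<^sub>R u) \<le> e"
      using u by (simp add: field_simps)
    then have "x /\<^sub>R u \<in> K"
      using x by (intro e subspace_scale[OF subspace_Rn])
    with u show ?thesis by (auto simp: mem_scale_image)
  qed
  have mem: "x /\<^sub>R (s + 1 / real (Suc k)) \<in> K" for k
  proof -
    have "Inf ?G < s + 1 / real (Suc k)"
      using le by (simp add: gauge_of_def less_add_same_cancel1 add_pos_pos order_le_less_trans)
    then obtain u where u: "0 < u" "x \<in> (*\<^sub>R) u ` K" "u < s + 1 / real (Suc k)"
      using cInf_lessD[OF ne] by blast
    then have "x \<in> (*\<^sub>R) (s + 1 / real (Suc k)) ` K"
      using star_scale_mono[of K u "s + 1 / real (Suc k)"] body_scale by auto
    then show ?thesis
      using s by (simp add: mem_scale_image add_pos_pos less_imp_neq[symmetric])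
  qed
  have "(\<lambda>k. s + 1 / real (Suc k)) \<longlonglongrightarrow> s + 0"
    by (intro tendsto_intros LIMSEQ_inverse_real_of_nat[unfolded inverse_eq_divide])
  then have lim: "(\<lambda>k. x /\<^sub>R (s + 1 / real (Suc k))) \<longlonglongrightarrow> x /\<^sub>R s"
    using s by (intro tendsto_intros) auto
  have "closed K"
    using K by (simp add: body_def compact_imp_closed)
  then have "x /\<^sub>R s \<in> K"
    by (rule closed_sequentially[OF _ _ lim]) (use mem in blast)
  then show "x \<in> (*\<^sub>R) s ` K"
    using s by (simp add: mem_scale_image)
qed

lemma gauge_pos:
  assumes x: "x \<in> Rn n" "x \<noteq> 0"
  shows "0 < gauge_of K x"
proof (rule ccontr)
  assume le: "\<not> 0 < gauge_of K x"
  obtain R where R: "0 < R" "\<And>x. x \<in> K \<Longrightarrow> norm x \<le> R"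
    using body_bounded by blast
  \<comment> \<open>Dividing \<open>x\<close> by this \<open>s\<close> gives norm
    \<open>2 * R\<close>, too large for a point of \<open>K\<close>.\<close>
  define s where "s = norm x / (2 * R)"
  have s: "0 < s" using x R by (simp add: s_def)
  then have "x /\<^sub>R s \<in> K"
    using gauge_le_iff[OF s x(1)] le by (simp add: mem_scale_image)
  then have "norm (x /\<^sub>R s) \<le> R" by (rule R)
  then show False
    using s x(2) R(1) by (simp add: s_def field_simps)
qed

lemma gauge_zero: "gauge_of K 0 = 0"
proof -
  have "{s. 0 < s \<and> 0 \<in> (*\<^sub>R) s ` K} = {0<..}"
    using body_zero by (auto simp: image_iff intro!: bexI[of _ 0])
  then show ?thesis by (simp add: gauge_of_def)
qed

lemma gauge_nonneg: "x \<in> Rn n \<Longrightarrow> 0 \<le> gauge_of K x"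
  using gauge_pos[of x] gauge_zero by (cases "x = 0") auto

lemma measurable_gauge: "gauge_of K \<in> borel_measurable (borel_Rn n)"
proof (rule borel_measurableI_le)
  fix y :: real
  have Int: "A \<inter> Rn n \<in> sets (borel_Rn n)" if "A \<in> sets borel" for A
    using imageI[OF that, of "(\<inter>) (Rn n)"] by (simp only: sets_restrict_space Int_commute)
  consider "y < 0" | "y = 0" | "0 < y" by linarith
  then have "{x \<in> Rn n. gauge_of K x \<le> y} \<in> sets (borel_Rn n)"
  proof cases
    case 1
    then have "{x \<in> Rn n. gauge_of K x \<le> y} = {}"
      using gauge_nonneg by force
    then show ?thesis by (simp only: sets.empty_sets)
  next
    case 2
    then have "{x \<in> Rn n. gauge_of K x \<le> y} = {0} \<inter> Rn n"
      using gauge_pos gauge_zero by force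
    moreover have "{0 :: nat \<Rightarrow>\<^sub>0 real} \<in> sets borel"
      by (intro borel_closed) simp
    ultimately show ?thesis
      using Int by (simp only:)
  next
    case 3
    then have "{x \<in> Rn n. gauge_of K x \<le> y} = (*\<^sub>R) y ` K \<inter> Rn n"
      using gauge_le_iff by auto
    moreover have "compact ((*\<^sub>R) y ` K)"
      using K by (auto simp: body_def intro: compact_scaling)
    then have "(*\<^sub>R) y ` K \<in> sets borel"
      by (intro borel_closed compact_imp_closed)
    ultimately show ?thesis
      using Int by (simp only:)
  qed
  then show "{x \<in> space (borel_Rn n). gauge_of K x \<le> y} \<in> sets (borel_Rn n)"
    by simp
qed

end

section \<open>Markov's inequality and the volume of the intersection with the ball\<close>

context euclidean_Rn
begin

text \<open>A qualitative inclusion with no control of \<open>R\<close>. It makes the gauge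
  integrable on the sphere and starts the absorption iteration.\<close>

lemma unit_ball_absorbed:
  assumes n: "0 < n" and K: "body n K"
  obtains R where "0 < R" "unit_ball n ip \<subseteq> (*\<^sub>R) R ` K"
proof -
  obtain r where r: "0 \<le> r" "unit_ball n ip \<subseteq> {x \<in> Rn n. \<forall>i<n. \<bar>Poly_Mapping.lookup x i\<bar> \<le> r}"
    using unit_ball_subset_cube[OF ip n] .
  obtain e where e: "0 < e" "\<And>x. x \<in> Rn n \<Longrightarrow> norm x \<le> e \<Longrightarrow> x \<in> K"
    using body_norm_ball[OF K] by blast
  define R where "R = 1 + (\<Sum>i<n. r * norm (std_vec i))"
  have R: "0 < R" unfolding R_def using r by (intro add_pos_nonneg sum_nonneg) auto
  show ?thesis
  proof (rule that)
    show "0 < R / e" using R e by simp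
    show "unit_ball n ip \<subseteq> (*\<^sub>R) (R / e) ` K"
    proof
      fix x assume "x \<in> unit_ball n ip"
      then have x: "x \<in> Rn n" "\<And>i. i < n \<Longrightarrow> \<bar>Poly_Mapping.lookup x i\<bar> \<le> r" using r by auto
      have "norm x = norm (\<Sum>i<n. Poly_Mapping.lookup x i *\<^sub>R std_vec i)"
        using Rn_expand[OF x(1)] by simp
      also have "\<dots> \<le> (\<Sum>i<n. r * norm (std_vec i))"
        using x(2) by (intro sum_norm_le) (auto intro!: mult_right_mono)
      finally have "norm x \<le> R" by (simp add: R_def)
      then have "norm (x /\<^sub>R (R / e)) \<le> e"
        using R e(1) by (simp add: field_simps)
      then have "x /\<^sub>R (R / e) \<in> K"
        using x(1) by (intro e Rn_closed)
      then show "x \<in> (*\<^sub>R) (R / e) ` K"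
        using R e(1) by (simp add: mem_scale_image)
    qed
  qed
qed

text \<open>By Markov, directions with gauge at least three times the mean have measure at most 1/3.
  As the sphere carries the cone measure, the other directions fill at least half of the ball's
  volume, and star-shapedness keeps their radii inside the dilate of \<open>K\<close>.\<close>

lemma mean_gauge_pos_half:
  assumes n: "0 < n" and K: "body n K"
  shows "0 < mean_gauge n ip K"
    and "measure (lebesgue_Rn n) (unit_ball n ip) \<le>
      2 * measure (lebesgue_Rn n) (unit_ball n ip \<inter> (*\<^sub>R) (3 * mean_gauge n ip K) ` K)"
    and "unit_ball n ip \<inter> (*\<^sub>R) (3 * mean_gauge n ip K) ` K \<in> sets (borel_Rn n)"
proof -
  let ?L = "lebesgue_Rn n" and ?D = "unit_ball n ip"
  let ?\<sigma> = "sphere_measure n ip" and ?M = "mean_gauge n ip K"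
  have sphere: "space ?\<sigma> = unit_sphere n ip" by (rule space_sphere_measure(1)[OF ip])
  then have one: "emeasure ?\<sigma> (space ?\<sigma>) = 1"
    by (simp add: sphere_measure_normalized[OF ip n])
  then interpret S: finite_measure ?\<sigma>
    by (intro finite_measureI) simp
  have sphereD: "x \<in> Rn n" "x \<noteq> 0" "x \<in> ?D" if "x \<in> unit_sphere n ip" for x
    using that by (auto simp: unit_sphere_def unit_ball_def enorm_def)
  have "sets ?\<sigma> = sets (restrict_space (borel_Rn n) (unit_sphere n ip))"
    unfolding sphere_measure_def by (intro sets_restrict_space_cong) simp
  then have g_meas: "gauge_of K \<in> borel_measurable ?\<sigma>"
    using measurable_restrict_space1[OF measurable_gauge[OF K]] by (simp cong: measurable_cong_sets)
  obtain R where R: "0 < R" "?D \<subseteq> (*\<^sub>R) R ` K"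
    using unit_ball_absorbed[OF n K] .
  have g_int: "integrable ?\<sigma> (gauge_of K)"
  proof (rule S.integrable_const_bound[where B = R])
    have "norm (gauge_of K x) \<le> R" if "x \<in> space ?\<sigma>" for x
      using that sphere sphereD[of x] R gauge_le_iff[OF K R(1), of x] gauge_nonneg[OF K, of x] by auto
    then show "AE x in ?\<sigma>. norm (gauge_of K x) \<le> R" by (intro AE_I2)
  qed (rule g_meas)
  have g_pos: "0 < gauge_of K x" if "x \<in> space ?\<sigma>" for x
    using that sphere sphereD[of x] gauge_pos[OF K, of x] by auto
  have g_AE: "AE x in ?\<sigma>. 0 \<le> gauge_of K x"
    using g_pos by (intro AE_I2 less_imp_le)
  \<comment> \<open>The gauge is positive at every point of the sphere, so a zero integral would
    contradict total mass 1.\<close>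
  have "?M \<noteq> 0"
  proof
    assume "?M = 0"
    then have "AE x in ?\<sigma>. gauge_of K x = 0"
      using integral_nonneg_eq_0_iff_AE[OF g_int g_AE] by (simp add: mean_gauge_def)
    moreover have "AE x in ?\<sigma>. gauge_of K x = 0 \<longrightarrow> False"
      using g_pos by (intro AE_I2) force
    ultimately have "AE x in ?\<sigma>. False"
      by (rule AE_mp)
    then show False
      using one by (simp add: ae_filter_eq_bot_iff flip: trivial_limit_def)
  qed
  moreover have "0 \<le> ?M"
    unfolding mean_gauge_def using g_AE by (rule integral_nonneg_AE)
  ultimately show M: "0 < ?M" by simp
  let ?H = "?D \<inter> (*\<^sub>R) (3 * ?M) ` K"
  have D: "?D \<in> sets (borel_Rn n)" by (rule sets_unit_ball[OF ip])
  have H_eq: "?H = ?D \<inter> {x \<in> space (borel_Rn n). gauge_of K x \<le> 3 * ?M}"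
    using gauge_le_iff[OF K, of "3 * ?M"] M by (auto simp: unit_ball_def)
  show H: "?H \<in> sets (borel_Rn n)"
    unfolding H_eq using D measurable_gauge[OF K] by measurable
  \<comment> \<open>Strict, so that the complement of \<open>A\<close> is exactly the Markov
    event.\<close>
  define A where "A = {x \<in> space ?\<sigma>. gauge_of K x < 3 * ?M}"
  have A: "A \<in> sets ?\<sigma>" unfolding A_def using g_meas by measurable
  have "measure ?\<sigma> {x \<in> space ?\<sigma>. 3 * ?M \<le> gauge_of K x} \<le> ?M / (3 * ?M)"
    unfolding mean_gauge_def[symmetric]
    using integral_Markov_inequality_measure[OF g_int sets.top g_AE, of "3 * ?M"] M by (simp add: mean_gauge_def)
  moreover have "space ?\<sigma> - A = {x \<in> space ?\<sigma>. 3 * ?M \<le> gauge_of K x}"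
    by (auto simp: A_def)
  ultimately have A_half: "1 / 2 \<le> measure ?\<sigma> A"
    using S.finite_measure_compl[OF A] one M by (simp add: measure_def)
  define Q where "Q = {x \<in> ?D. x /\<^sub>R enorm ip x \<in> A}"
  have Q_sub: "Q \<subseteq> ?H"
  proof
    fix x assume x: "x \<in> Q"
    then have xD: "x \<in> Rn n" "enorm ip x \<le> 1" by (auto simp: Q_def unit_ball_def)
    have u: "x /\<^sub>R enorm ip x \<in> unit_sphere n ip" "gauge_of K (x /\<^sub>R enorm ip x) < 3 * ?M"
      using x sphere by (auto simp: Q_def A_def)
    then have "x \<noteq> 0" using sphereD(2)[OF u(1)] by auto
    then have e: "0 < enorm ip x" using enorm_pos xD by blast
    have "x /\<^sub>R enorm ip x \<in> (*\<^sub>R) (3 * ?M) ` K"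
      using gauge_le_iff[OF K, of "3 * ?M" "x /\<^sub>R enorm ip x"] u M sphereD(1)[OF u(1)] by simp
    then obtain k where k: "k \<in> K" "x /\<^sub>R enorm ip x = (3 * ?M) *\<^sub>R k" by blast
    then have "x = enorm ip x *\<^sub>R (3 * ?M) *\<^sub>R k"
      using e by (metis divideR_right less_irrefl)
    then have "x = (3 * ?M) *\<^sub>R (enorm ip x *\<^sub>R k)" by (simp add: mult.commute)
    \<comment> \<open>The step from the sphere to the ball: shrinking by
      \<open>enorm ip x \<le> 1\<close> stays in \<open>K\<close>.\<close>
    moreover have "enorm ip x *\<^sub>R k \<in> K"
      using e xD(2) by (intro body_scale[OF K _ _ k(1)]) auto
    ultimately have "x \<in> (*\<^sub>R) (3 * ?M) ` K" by (rule image_eqI)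
    with x show "x \<in> ?H" by (simp add: Q_def)
  qed
  have "emeasure ?\<sigma> A = emeasure ?L Q / emeasure ?L ?D"
    using emeasure_sphere_measure[OF ip A] by (simp add: Q_def)
  also have "\<dots> \<le> emeasure ?L ?H / emeasure ?L ?D"
    using Q_sub H by (intro divide_right_mono_ennreal emeasure_mono) (auto simp: sets_lebesgue_Rn)
  finally have le: "emeasure ?\<sigma> A \<le> emeasure ?L ?H / emeasure ?L ?D" .
  define d where "d = measure ?L ?D"
  have d: "0 < d" "emeasure ?L ?D = ennreal d"
    using emeasure_unit_ball[OF ip n]
    by (auto simp: d_def measure_def enn2real_positive_iff less_top zero_less_iff_neq_zero)
  have "emeasure ?L ?H \<le> ennreal d"
    unfolding d(2)[symmetric] using D by (intro emeasure_mono) (auto simp: sets_lebesgue_Rn)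
  then have h: "emeasure ?L ?H = ennreal (measure ?L ?H)"
    by (intro emeasure_eq_ennreal_measure) (auto simp: top_unique)
  have "ennreal (measure ?\<sigma> A) \<le> ennreal (measure ?L ?H / d)"
    using le d h by (simp add: S.emeasure_eq_measure divide_ennreal)
  then have "measure ?\<sigma> A \<le> measure ?L ?H / d"
    using d(1) by (simp add: ennreal_le_iff)
  with A_half have "1 / 2 \<le> measure ?L ?H / d" by linarith
  then show "measure ?L ?D \<le> 2 * measure ?L ?H"
    using d(1) by (simp add: d_def field_simps)
qed

end

subsection \<open>The projection\<close>

text \<open>A separated set of largest cardinality is a covering. Separation by \<open>t\<close>
  makes the sets \<open>a *\<^sub>R x + H\<close> disjoint, because a common point would express
  \<open>a *\<^sub>R (x - x')\<close> as \<open>s\<close> times a difference of two points of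
  \<open>K\<close>, and such differences lie in \<open>K\<close> scaled by
  \<open>2 powr (1 / p)\<close>. Dividing by \<open>a\<close> gives \<open>t\<close>.\<close>

lemma body_covering:
  assumes n: "0 < n" and ip: "inner_product_on n ip" and K: "body n K"
    and p: "0 < p" "p_convex p K" and a: "0 < a"
  obtains X where "finite X" "X \<subseteq> unit_ball n ip" "real (card X) \<le> 4 * exp (a\<^sup>2 * n / 2)"
    "\<And>y. y \<in> unit_ball n ip \<Longrightarrow>
      \<exists>x\<in>X. \<exists>k\<in>K. y = x + (3 * mean_gauge n ip K * 2 powr (1 / p) / a) *\<^sub>R k"
proof -
  interpret euclidean_Rn n ip by unfold_locales (rule ip)
  define s where "s = 3 * mean_gauge n ip K"
  define t where "t = s * 2 powr (1 / p) / a"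
  define H where "H = unit_ball n ip \<inter> (*\<^sub>R) s ` K"
  have s: "0 < s" using mean_gauge_pos_half(1)[OF n K] by (simp add: s_def)
  define sepd where "sepd Y \<longleftrightarrow> finite Y \<and> Y \<subseteq> unit_ball n ip \<and>
    (\<forall>x\<in>Y. \<forall>x'\<in>Y. x \<noteq> x' \<longrightarrow> x - x' \<notin> (*\<^sub>R) t ` K)" for Y
  have bound: "real (card Y) \<le> 4 * exp (a\<^sup>2 * n / 2)" if Y: "sepd Y" for Y
  proof (rule packing_bound[OF n])
    show "H \<in> sets (borel_Rn n)" "measure (lebesgue_Rn n) (unit_ball n ip) \<le> 2 * measure (lebesgue_Rn n) H"
      using mean_gauge_pos_half(2,3)[OF n K] by (simp_all add: H_def s_def)
    show "H \<subseteq> unit_ball n ip" by (simp add: H_def)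
    show "- y \<in> H" if "y \<in> H" for y
      using that s body_uminus[OF K] enorm_uminus by (auto simp: H_def unit_ball_def mem_scale_image)
    show "finite Y" "Y \<subseteq> unit_ball n ip" using Y by (auto simp: sepd_def)
    show "0 \<le> a" using a by simp
    fix x x' y y' assume x: "x \<in> Y" "x' \<in> Y" "x \<noteq> x'" and y: "y \<in> H" "y' \<in> H"
    show "a *\<^sub>R x + y \<noteq> a *\<^sub>R x' + y'"
    proof
      assume eq: "a *\<^sub>R x + y = a *\<^sub>R x' + y'"
      obtain k k' where k: "k \<in> K" "y = s *\<^sub>R k" and k': "k' \<in> K" "y' = s *\<^sub>R k'"
        using y by (auto simp: H_def)
      have "1 *\<^sub>R k' + 1 *\<^sub>R (- k) \<in> (*\<^sub>R) ((1 powr p + 1 powr p) powr (1 / p)) ` K"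
        using k k' body_uminus[OF K] by (intro p_convex_lincomb p) auto
      then obtain z where z: "z \<in> K" "k' - k = 2 powr (1 / p) *\<^sub>R z"
        by auto
      have "a *\<^sub>R (x - x') = s *\<^sub>R (k' - k)"
        using eq k(2) k'(2) by (simp add: algebra_simps)
      then have "(x - x') = (s / a) *\<^sub>R (k' - k)"
        using a by (metis divideR_right less_irrefl scaleR_scaleR divide_inverse mult.commute)
      then have "x - x' = t *\<^sub>R z"
        by (simp add: z(2) t_def)
      then show False using Y x z(1) by (auto simp: sepd_def)
    qed
  qed
  \<comment> \<open>The packing bound gives a uniform bound on cardinalities, so a largest separated
    set exists.\<close>
  have "card Y < Suc (nat \<lceil>4 * exp (a\<^sup>2 * n / 2)\<rceil>)" if "sepd Y" for Y
    using bound[OF that] by linarith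
  moreover have "sepd {}" by (simp add: sepd_def)
  ultimately obtain X where X: "sepd X" "\<And>Y. sepd Y \<Longrightarrow> card Y \<le> card X"
    using Lattices_Big.ex_has_greatest_nat[of sepd "{}" card] by blast
  have cov: "\<exists>x\<in>X. \<exists>k\<in>K. y = x + t *\<^sub>R k" if y: "y \<in> unit_ball n ip" for y
  proof (cases "y \<in> X")
    case True
    then show ?thesis using body_zero[OF K] by (intro bexI[of _ y] bexI[of _ 0]) auto
  next
    case False
    then have "card (insert y X) = Suc (card X)"
      using X(1) by (simp add: sepd_def)
    then have "\<not> sepd (insert y X)"
      using X(2)[of "insert y X"] by linarith
    then obtain x where x: "x \<in> X" "y - x \<in> (*\<^sub>R) t ` K \<or> x - y \<in> (*\<^sub>R) t ` K"
      using X(1) y unfolding sepd_def by blast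
    have "y - x \<in> (*\<^sub>R) t ` K" if "x - y \<in> (*\<^sub>R) t ` K"
    proof -
      from that obtain k where "k \<in> K" "x - y = t *\<^sub>R k" by blast
      then have "y - x = t *\<^sub>R (- k)" "- k \<in> K"
        using body_uminus[OF K] by (auto simp: algebra_simps)
      then show ?thesis by blast
    qed
    with x obtain k where "k \<in> K" "y - x = t *\<^sub>R k" by blast
    then show ?thesis using x(1) by (metis add.commute diff_add_cancel)
  qed
  show ?thesis
    by (rule that[of X]) (use X(1) bound[OF X(1)] cov in \<open>auto simp: sepd_def t_def s_def\<close>)
qed

section \<open>The orthogonal projection with prescribed kernel\<close>

context euclidean_Rn
begin

lemma residual_projection:
  assumes U: "orthonormal U"
  obtains P where "orthogonal_projection n ip P" "dim (P ` Rn n) = n - card U"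
    "\<And>x. x \<in> Rn n \<Longrightarrow> P x = residual U x"
proof -
  \<comment> \<open>Defined through coordinates, so that \<open>P\<close> is linear on the whole
    type and not only on \<open>Rn n\<close>.\<close>
  define P where "P x = (\<Sum>i<n. Poly_Mapping.lookup x i *\<^sub>R residual U (std_vec i))" for x
  have lin: "linear P"
    by (rule linearI)
       (simp_all add: P_def lookup_add lookup_scaleR scaleR_add_left sum.distrib scaleR_sum_right)
  have P_eq: "P x = residual U x" if x: "x \<in> Rn n" for x
  proof -
    have "P x = (\<Sum>i<n. Poly_Mapping.lookup x i *\<^sub>R std_vec i) -
        (\<Sum>i<n. \<Sum>u\<in>U. (Poly_Mapping.lookup x i * ip (std_vec i) u) *\<^sub>R u)"
      by (simp add: P_def residual_def scaleR_diff_right sum_subtractf scaleR_sum_right)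
    also have "(\<Sum>i<n. \<Sum>u\<in>U. (Poly_Mapping.lookup x i * ip (std_vec i) u) *\<^sub>R u) =
        (\<Sum>u\<in>U. (\<Sum>i<n. Poly_Mapping.lookup x i * ip (std_vec i) u) *\<^sub>R u)"
      by (subst sum.swap) (simp add: scaleR_sum_left)
    also have "\<dots> = (\<Sum>u\<in>U. ip (\<Sum>i<n. Poly_Mapping.lookup x i *\<^sub>R std_vec i) u *\<^sub>R u)"
      using orthonormalD(2)[OF U]
      by (intro sum.cong refl arg_cong2[of _ _ _ _ "(*\<^sub>R)"] ip_lincomb_left[symmetric])
         (auto simp: std_vec_mem_Rn)
    finally show ?thesis
      using Rn_expand[OF x] by (simp add: residual_def)
  qed
  have P_mem: "P x \<in> Rn n" if "x \<in> Rn n" for x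
    using P_eq[OF that] residual_mem[OF U that] by simp
  have proj: "orthogonal_projection n ip P"
    unfolding orthogonal_projection_def
  proof (intro conjI ballI lin)
    show "P ` Rn n \<subseteq> Rn n" using P_mem by blast
    show "P (P x) = P x" if "x \<in> Rn n" for x
      using P_eq[OF P_mem[OF that]] P_eq[OF that] residual_idem[OF U that] by simp
    show "ip (P x) y = ip x (P y)" if "x \<in> Rn n" "y \<in> Rn n" for x y
      using that P_eq residual_mem[OF U that(2)]
      by (simp add: ip_residual[OF U] ip_commute[of x "residual U y"] ip_commute[of y x] mult.commute)
  qed
  \<comment> \<open>The range of \<open>P\<close> is spanned by a completion \<open>V\<close> of
    \<open>U\<close>, which gives the rank.\<close>
  obtain V where V: "U \<inter> V = {}" "orthonormal (U \<union> V)" "card (U \<union> V) = n"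
    using orthonormal_completion[OF U] .
  have V': "orthonormal V" by (rule orthonormal_subset[OF V(2)]) auto
  have "P ` Rn n = span V"
  proof
    show "P ` Rn n \<subseteq> span V"
    proof (intro subsetI, elim imageE)
      fix z x assume "z = P x" "x \<in> Rn n"
      then show "z \<in> span V"
        by (simp add: P_eq residual_eq_lincomb(1)[OF V(2,3,1)] span_sum span_scale span_base)
    qed
    have "V \<subseteq> P ` Rn n"
    proof
      fix v assume v: "v \<in> V"
      then have vR: "v \<in> Rn n" using orthonormalD(2)[OF V'] by simp
      have "(\<Sum>u\<in>U. ip v u *\<^sub>R u) = 0"
        using orthonormalD(3)[OF V(2)] V(1) v by (intro sum.neutral) auto
      then have "P v = v" by (simp add: P_eq[OF vR] residual_def)
      then show "v \<in> P ` Rn n" using vR by (metis imageI)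
    qed
    then show "span V \<subseteq> P ` Rn n"
      by (intro span_minimal linear_subspace_image[OF lin subspace_Rn])
  qed
  then have "dim (P ` Rn n) = card V"
    by (simp add: dim_eq_card_independent[OF orthonormal_independent[OF V']])
  also have "\<dots> = n - card U"
    using card_Un_disjoint[of U V] V(1,3) orthonormalD(1)[OF U] orthonormalD(1)[OF V'] by simp
  finally show ?thesis using that proj P_eq by blast
qed

end

text \<open>Here \<open>4 * exp (\<mu>\<^sup>2 * n / 32)\<close> is the size of the covering with mesh parameter \<open>\<mu> / 4\<close>.\<close>

lemma sign_steps_beat_covering:
  fixes \<mu> N :: real and n m :: nat
  assumes \<mu>: "0 < \<mu>" "\<mu> < 1" and n: "48 < \<mu>\<^sup>2 * n" and m: "\<mu> * n \<le> m"
    and N: "0 \<le> N" "N \<le> 4 * exp ((\<mu> / 4)\<^sup>2 * n / 2)"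
  shows "(5 / 6) ^ m * N \<le> (exp (- \<mu> / 24))\<^sup>2 ^ n"
proof -
  have le: "\<mu>\<^sup>2 * n \<le> \<mu> * n"
    using \<mu> by (intro mult_right_mono) (auto simp: power2_eq_square mult_left_le)
  have le_mn: "0 \<le> \<mu> * n" using \<mu> by simp
  have "(5 / 6 :: real) ^ m \<le> exp (- 1 / 6) ^ m"
    using exp_ge_add_one_self[of "- 1 / 6"] by (intro power_mono) auto
  also have "\<dots> = exp (- (m / 6))" by (simp add: exp_of_nat_mult[symmetric])
  also have "\<dots> \<le> exp (- (\<mu> * n / 6))" using m by simp
  finally have 1: "(5 / 6 :: real) ^ m \<le> exp (- (\<mu> * n / 6))" .
  have "(4 :: real) = 2\<^sup>2" by simp
  also have "\<dots> \<le> (exp 1)\<^sup>2"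
    using exp_ge_add_one_self[of 1] by (intro power_mono) auto
  also have "\<dots> = exp 2" by (simp add: exp_double[symmetric])
  \<comment> \<open>The origin of the threshold 48: the constant 4 is at most \<open>exp 2\<close>,
    and \<open>\<mu> * n > 48\<close> makes 2 at most \<open>\<mu> * n / 24\<close>.\<close>
  also have "\<dots> \<le> exp (\<mu> * n / 24)" using le n by simp
  finally have "N \<le> exp (\<mu> * n / 24) * exp ((\<mu> / 4)\<^sup>2 * n / 2)"
    using N(2) by (meson exp_ge_zero mult_right_mono order_trans)
  then have "(5 / 6) ^ m * N \<le> exp (- (\<mu> * n / 6)) * (exp (\<mu> * n / 24) * exp ((\<mu> / 4)\<^sup>2 * n / 2))"
    using 1 N(1) by (intro mult_mono) auto
  also have "\<dots> = exp (- (\<mu> * n / 6) + (\<mu> * n / 24 + (\<mu> / 4)\<^sup>2 * n / 2))"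
    by (simp only: exp_add)
  \<comment> \<open>As \<open>\<mu>\<^sup>2 \<le> \<mu>\<close>, the budget is
    \<open>1 / 6 - 1 / 24 - 1 / 32 = 9 / 96\<close>, which exceeds \<open>1 / 12\<close>.\<close>
  also have "\<dots> \<le> exp (- (\<mu> * n / 12))"
  proof -
    have "(\<mu> / 4)\<^sup>2 * n / 2 = \<mu>\<^sup>2 * n / 32" by (simp add: power_divide)
    then show ?thesis using le le_mn by (simp only: exp_le_cancel_iff)
  qed
  also have "\<dots> = (exp (- \<mu> / 24))\<^sup>2 ^ n"
    by (simp add: exp_of_nat_mult[symmetric] exp_double[symmetric] field_simps)
  finally show ?thesis .
qed

text \<open>The base \<open>exp 12\<close> turns the \<open>p\<close>-th power of the constant in
  the theorem into \<open>(2 / p) ^ 12\<close>. This has to outweigh the factor of order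
  \<open>1 / (\<mu> * p)\<close> from \<open>1 - r powr p\<close> together with a numerical
  constant; the extra \<open>1 / \<mu>\<close> comes from the exponent
  \<open>1 + 1 / p\<close>.\<close>

lemma absorption_constant:
  fixes p \<mu> M :: real
  assumes p: "0 < p" "p \<le> 1" and \<mu>: "0 < \<mu>" "\<mu> < 1" and M: "0 < M"
  shows "(3 * M * 2 powr (1 / p) / (\<mu> / 4)) powr p <
    (1 - exp (- \<mu> / 24) powr p) * (exp 12 powr (ln (2 / p) / p) * M / \<mu> powr (1 + 1 / p)) powr p"
proof -
  define x where "x = \<mu> * p / 24"
  define W where "W = (M / \<mu>) powr p"
  have W: "0 < W" using M \<mu> by (simp add: W_def)
  have "\<mu> * p \<le> 1 * 1" using p \<mu> by (intro mult_mono) auto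
  then have x: "0 < x" "x \<le> 1" using p \<mu> by (auto simp: x_def)
  have "exp (- \<mu> / 24) powr p = exp (- x)"
    by (simp add: x_def powr_def mult.commute)
  moreover have "x\<^sup>2 \<le> x"
    using x by (simp add: power2_eq_square mult_left_le)
  \<comment> \<open>Here \<open>5 / 18 = 1 / 3 - 1 / 18\<close>, with \<open>x\<^sup>2\<close>
    bounded by \<open>x\<close>.\<close>
  ultimately have 1: "5 / 18 * x \<le> 1 - exp (- \<mu> / 24) powr p"
    using exp_minus_le_quadratic[of x] x by simp
  have "exp 12 powr (ln (2 / p)) = (2 / p) ^ 12"
    using p by (simp add: powr_def mult.commute flip: powr_realpow)
  also have "\<dots> = (2 / p) ^ (11 + 1)" by simp
  also have "\<dots> = (2 / p) ^ 11 * (2 / p)" by (simp only: power_add power_one_right)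
  \<comment> \<open>One factor \<open>1 / p\<close> is kept to cancel the \<open>p\<close> in
    \<open>x\<close>; the other eleven factors are bounded below by 2.\<close>
  also have "\<dots> \<ge> 2 ^ 11 * (2 / p)"
    using p by (intro mult_right_mono power_mono) (auto simp: field_simps)
  finally have 2: "4096 / p \<le> exp 12 powr (ln (2 / p))" by simp
  have "(3 * M * 2 powr (1 / p) / (\<mu> / 4)) powr p = (12 * (M / \<mu>) * 2 powr (1 / p)) powr p"
    by (simp add: field_simps)
  also have "\<dots> = 12 powr p * W * 2"
    using p M \<mu> by (simp add: powr_mult powr_powr W_def del: times_divide_eq_right)
  also have "\<dots> \<le> 12 * W * 2"
    using W p powr_mono[of p 1 "12 :: real"] by simp
  \<comment> \<open>Both \<open>\<mu>\<close> and \<open>p\<close> cancel, leaving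
    \<open>24 < 5 * 4096 / 432\<close>, which is about 47.4.\<close>
  also have "\<dots> < (5 / 18 * x) * (4096 / p) * (W / \<mu>)"
    using W p \<mu> by (simp add: x_def field_simps)
  also have "\<dots> \<le> (1 - exp (- \<mu> / 24) powr p) * exp 12 powr (ln (2 / p)) * (W / \<mu>)"
    using 1 2 W \<mu> p x by (intro mult_right_mono mult_mono) auto
  also have "exp 12 powr (ln (2 / p)) * (W / \<mu>) =
      (exp 12 powr (ln (2 / p) / p) * M / \<mu> powr (1 + 1 / p)) powr p"
  proof -
    have "(1 + 1 / p) * p = p + 1" using p by (simp add: field_simps)
    then show ?thesis
      using p M \<mu> by (simp add: powr_divide powr_mult powr_powr powr_add W_def)
  qed
  then have "(1 - exp (- \<mu> / 24) powr p) * exp 12 powr (ln (2 / p)) * (W / \<mu>) =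
      (1 - exp (- \<mu> / 24) powr p) * (exp 12 powr (ln (2 / p) / p) * M / \<mu> powr (1 + 1 / p)) powr p"
    by (simp only: mult.assoc)
  finally show ?thesis .
qed

theorem theorem2:
  "\<exists>c C :: real. 0 < c \<and> 1 < C \<and>
     (\<forall>(l::real) (n::nat) (p::real) ip K.
        0 < l \<and> l < 1 \<and> 0 < n \<and> real n > c / (1 - l)\<^sup>2 \<and> 0 < p \<and> p \<le> 1 \<and>
        inner_product_on n ip \<and> body n K \<and> p_convex p K \<longrightarrow>
        (\<exists>P. orthogonal_projection n ip P \<and> dim (P ` Rn n) = nat \<lfloor>l * real n\<rfloor> \<and>
             P ` unit_ball n ip \<subseteq>
               (*\<^sub>R) (C powr (ln (2 / p) / p) * mean_gauge n ip K / (1 - l) powr (1 + 1 / p)) ` (P ` K)))"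
proof (rule exI[of _ 48], rule exI[of _ "exp 12"], intro conjI allI impI)
  fix l :: real and n :: nat and p :: real and ip K
  assume asm: "0 < l \<and> l < 1 \<and> 0 < n \<and> 48 / (1 - l)\<^sup>2 < real n \<and> 0 < p \<and> p \<le> 1 \<and>
    inner_product_on n ip \<and> body n K \<and> p_convex p K"
  then have l: "0 < l" "l < 1" and n: "0 < n" "48 / (1 - l)\<^sup>2 < real n" and p: "0 < p" "p \<le> 1"
    and ip: "inner_product_on n ip" and K: "body n K" "p_convex p K"
    by auto
  interpret euclidean_Rn n ip by unfold_locales (rule ip)
  define \<mu> where "\<mu> = 1 - l"
  define M where "M = mean_gauge n ip K"
  define r where "r = exp (- \<mu> / 24)"
  define t where "t = 3 * M * 2 powr (1 / p) / (\<mu> / 4)"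
  define B where "B = exp 12 powr (ln (2 / p) / p) * M / \<mu> powr (1 + 1 / p)"
  \<comment> \<open>The dimension of the kernel. Rounding the rank down gives
    \<open>m \<ge> \<mu> * n\<close>, the direction needed for the number of steps.\<close>
  define m where "m = n - nat \<lfloor>l * real n\<rfloor>"
  have \<mu>: "0 < \<mu>" "\<mu> < 1" using l by (auto simp: \<mu>_def)
  have M: "0 < M" using mean_gauge_pos_half(1)[OF n(1) K(1)] by (simp add: M_def)
  have r: "0 < r" "r < 1" using \<mu> by (auto simp: r_def)
  have t: "0 < t" and B: "0 < B" using M \<mu> by (auto simp: t_def B_def)
  have "l * real n \<le> real n" using l by (simp add: mult_left_le_one_le)
  then have fl: "nat \<lfloor>l * real n\<rfloor> \<le> n" "real (nat \<lfloor>l * real n\<rfloor>) \<le> l * real n"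
    using l by (simp_all add: nat_le_iff floor_le_iff)
  have m: "m \<le> n" "n - m = nat \<lfloor>l * real n\<rfloor>" "\<mu> * n \<le> m"
    using fl by (auto simp: m_def \<mu>_def of_nat_diff algebra_simps)
  have n48: "48 < \<mu>\<^sup>2 * n"
    using n(2) \<mu> by (simp add: \<mu>_def[symmetric] field_simps)
  obtain X where X: "finite X" "X \<subseteq> unit_ball n ip" "real (card X) \<le> 4 * exp ((\<mu> / 4)\<^sup>2 * n / 2)"
    and cov: "\<And>y. y \<in> unit_ball n ip \<Longrightarrow> \<exists>x\<in>X. \<exists>k\<in>K. y = x + t *\<^sub>R k"
    using body_covering[OF n(1) ip K(1) p(1) K(2), of "\<mu> / 4"] \<mu> unfolding t_def M_def by auto
  have XR: "x \<in> Rn n" "ip x x \<le> 1" if "x \<in> X" for x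
    using that X(2) by (auto simp: mem_unit_ball)
  obtain U where U: "orthonormal U" "card U = m"
    and contr: "(\<Sum>x\<in>X. ip (residual U x) (residual U x) ^ n) \<le> (5 / 6) ^ m * (\<Sum>x\<in>X. ip x x ^ n)"
    using orthonormal_contraction[OF m(1) X(1)] XR(1) by blast
  obtain P where P: "orthogonal_projection n ip P" "dim (P ` Rn n) = n - card U"
    and P_eq: "\<And>x. x \<in> Rn n \<Longrightarrow> P x = residual U x"
    using residual_projection[OF U(1)] by blast
  have lin: "linear P" and P_idem: "\<And>x. x \<in> Rn n \<Longrightarrow> P (P x) = P x"
    using P(1) by (auto simp: orthogonal_projection_def)
  have small: "P x /\<^sub>R r \<in> unit_ball n ip" if x: "x \<in> X" for x
  proof -
    let ?q = "\<lambda>x. ip (residual U x) (residual U x)"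
    have nonneg: "0 \<le> ?q y" if "y \<in> X" for y
      using residual_mem[OF U(1) XR(1)[OF that]] by (rule ip_self_nonneg)
    have "?q x ^ n \<le> (\<Sum>y\<in>X. ?q y ^ n)"
      using X(1) x nonneg by (intro member_le_sum) auto
    also have "\<dots> \<le> (5 / 6) ^ m * (\<Sum>y\<in>X. ip y y ^ n)" by (rule contr)
    also have "\<dots> \<le> (5 / 6) ^ m * (\<Sum>y\<in>X. 1)"
      using XR ip_self_nonneg by (intro mult_left_mono sum_mono power_le_one) auto
    also have "\<dots> \<le> (r\<^sup>2) ^ n"
      using sign_steps_beat_covering[OF \<mu> n48 m(3) _ X(3)] by (simp add: r_def)
    \<comment> \<open>A single term is bounded by the whole sum, and the \<open>n\<close>-th root is
      taken.\<close>
    finally have "?q x \<le> r\<^sup>2"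
      using n(1) nonneg[OF x] power_strict_mono[of "r\<^sup>2" "?q x" n] by (meson not_le zero_le_power2)
    then have "?q x / r\<^sup>2 \<le> 1" using r by simp
    moreover have "P x \<in> Rn n" using P_eq XR(1)[OF x] residual_mem[OF U(1)] by simp
    ultimately show ?thesis
      using P_eq[OF XR(1)[OF x]]
      by (simp add: mem_unit_ball Rn_closed ip_scale_left ip_scale_right divide_inverse power2_eq_square mult_ac)
  qed
  have "P ` unit_ball n ip \<subseteq> (*\<^sub>R) B ` (P ` K)"
  proof -
    obtain R where R: "0 < R" "unit_ball n ip \<subseteq> (*\<^sub>R) R ` K"
      using unit_ball_absorbed[OF n(1) K(1)] .
    show ?thesis
    proof (rule p_convex_absorb[OF p(1) p_convex_image[OF lin K(2)] _ R(1) _ _ r t B])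
      show "c *\<^sub>R x \<in> P ` K" if "0 \<le> c" "c \<le> 1" "x \<in> P ` K" for c x
        using that body_scale[OF K(1), of c] linear_scale[OF lin, of c, symmetric] by auto
      show "P ` unit_ball n ip \<subseteq> (*\<^sub>R) R ` (P ` K)"
        using image_mono[OF R(2), of P] by (simp add: image_image linear_scale[OF lin])
      show "\<exists>y\<in>P ` unit_ball n ip. \<exists>z\<in>P ` K. x = r *\<^sub>R y + t *\<^sub>R z" if "x \<in> P ` unit_ball n ip" for x
      proof -
        from that obtain y where y: "y \<in> unit_ball n ip" "x = P y" by blast
        with cov obtain w k where w: "w \<in> X" "k \<in> K" "y = w + t *\<^sub>R k" by blast
        have "x = P w + t *\<^sub>R P k"
          using w(3) y(2) by (simp add: linear_add[OF lin] linear_scale[OF lin])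
        \<comment> \<open>Idempotence shows that \<open>P w /\<^sub>R r\<close>, a point of the
          ball, is its own image. So \<open>P w\<close> is \<open>r\<close> times a point of the
          projected ball, which closes the self-inclusion.\<close>
        also have "P w = r *\<^sub>R P (P w /\<^sub>R r)"
          using r(1) P_idem[OF XR(1)[OF w(1)]] by (simp add: linear_scale[OF lin])
        finally show ?thesis using small[OF w(1)] w(2) by blast
      qed
      show "t powr p < (1 - r powr p) * B powr p"
        unfolding t_def r_def B_def by (rule absorption_constant[OF p \<mu> M])
    qed
  qed
  then show "\<exists>P. orthogonal_projection n ip P \<and> dim (P ` Rn n) = nat \<lfloor>l * real n\<rfloor> \<and>
      P ` unit_ball n ip \<subseteq>
        (*\<^sub>R) (exp 12 powr (ln (2 / p) / p) * mean_gauge n ip K / (1 - l) powr (1 + 1 / p)) ` (P ` K)"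
    using P U(2) m(2) unfolding B_def M_def \<mu>_def by auto
qed auto

end
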